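(* The class $\mathcal{G}_3$ consists of all finite $3$-groups of exponent $3$ and all finite groups in $\mathcal{A}_3$.
   Context: For a finite group $G$ and a subset $S\subseteq G$ with $S=S^{-1}$ and $1\notin S$, the Cayley graph $\mathrm{Cay}(G,S)$ is the graph with vertex set $G$ and edge set $\{\{g,sg\}: g\in G,\ s\in S\}$ (it need not be connected; it is regular of valency $|S|$). A graph is integral if all its eigenvalues (those of its adjacency matrix) are integers. $\mathcal{G}_3$ is the class of finite groups $G$ such that $\mathrm{Cay}(G,S)$ is integral for every $S\subseteq G$ with $S=S^{-1}$, $1\notin S$ and $|S|\le 3$. $\mathcal{A}_3$ is the class of finite groups all of whose Cayley graphs of valency $3$ are integral, where groups of odd order (which have no Cayley graph of valency $3$) are regarded as not belonging to $\mathcal{A}_3$.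
   Formalization: "Of exponent 3" is read as exponent dividing 3 (x³ = 1 for all x), which adds only the trivial group; with exponent exactly 3 the claim fails for that group, which lies in G_3 but has exponent 1 and odd order, so is not in A_3. *)

theory Defs
  imports "HOL-Algebra.Group" "HOL-Algebra.Coset" "Jordan_Normal_Form.Spectral_Radius"
begin

text \<open>A finite simple graph is a pair of a vertex set and a set of edges, each edge being a
  two-element set of vertices.\<close>

type_synonym 'a graph = "'a set \<times> 'a set set"

definition adjacency_matrix :: "'a list \<Rightarrow> 'a set set \<Rightarrow> complex mat" where
  "adjacency_matrix vs E =
     mat (length vs) (length vs) (\<lambda>(i, j). if {vs ! i, vs ! j} \<in> E then 1 else 0)"

text \<open>Matrices are indexed by natural numbers, so the vertices have to be listed. Different
  listings give permutation-similar matrices, so the choice of the listing is irrelevant.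
  Eigenvalues are taken in the complex numbers.\<close>

definition integral_graph :: "'a graph \<Rightarrow> bool" where
  "integral_graph \<Gamma> \<longleftrightarrow>
     (\<exists>vs. distinct vs \<and> set vs = fst \<Gamma> \<and> spectrum (adjacency_matrix vs (snd \<Gamma>)) \<subseteq> \<int>)"

definition connection_set :: "('a, 'b) monoid_scheme \<Rightarrow> 'a set \<Rightarrow> bool" where
  "connection_set G S \<longleftrightarrow> S \<subseteq> carrier G \<and> m_inv G ` S = S \<and> \<one>\<^bsub>G\<^esub> \<notin> S"

definition Cay :: "('a, 'b) monoid_scheme \<Rightarrow> 'a set \<Rightarrow> 'a graph" where
  "Cay G S = (carrier G, {{g, s \<otimes>\<^bsub>G\<^esub> g} | g s. g \<in> carrier G \<and> s \<in> S})"

definition class_G3 :: "('a, 'b) monoid_scheme set" where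
  "class_G3 = {G. group G \<and> finite (carrier G) \<and>
     (\<forall>S. connection_set G S \<and> card S \<le> 3 \<longrightarrow> integral_graph (Cay G S))}"

text \<open>The graph \<open>Cay G S\<close> is regular of valency \<open>card S\<close>. Groups of odd order have no Cayley
  graph of valency 3 and are excluded; the group of order 2 is a member, vacuously.\<close>

definition class_A3 :: "('a, 'b) monoid_scheme set" where
  "class_A3 = {G. group G \<and> finite (carrier G) \<and> even (Coset.order G) \<and>
     (\<forall>S. connection_set G S \<and> card S = 3 \<longrightarrow> integral_graph (Cay G S))}"

definition finite_p_group :: "nat \<Rightarrow> ('a, 'b) monoid_scheme \<Rightarrow> bool" where
  "finite_p_group p G \<longleftrightarrow> group G \<and> finite (carrier G) \<and> (\<exists>n. Coset.order G = p ^ n)"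

definition group_exponent :: "('a, 'b) monoid_scheme \<Rightarrow> nat" where
  "group_exponent G = (LEAST n. n > 0 \<and> (\<forall>x\<in>carrier G. x [^]\<^bsub>G\<^esub> n = \<one>\<^bsub>G\<^esub>))"

text \<open>As is customary for the variety of groups of exponent 3, ``of exponent 3'' means that
  \<open>x\<^sup>3 = 1\<close> for all \<open>x\<close>, i.e.\ that the exponent divides 3. The only group this
  adds to those of exponent exactly 3 is the trivial one, which is a 3-group and belongs to
  \<open>class_G3\<close> but not to \<open>class_A3\<close>.\<close>

definition three_groups_of_exponent_3 :: "('a, 'b) monoid_scheme set" where
  "three_groups_of_exponent_3 = {G. finite_p_group 3 G \<and> group_exponent G dvd 3}"

end

theory Submission
  imports Defs "HOL-Algebra.Multiplicative_Group" "HOL-Algebra.Sylow"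
begin

text \<open>A Cayley graph is integral iff all eigenvalues of \<open>f \<mapsto> (\<lambda>g. \<Sum>s\<in>S. f (s \<otimes> g))\<close> are
  integers, so it suffices to exhibit eigenfunctions. Powers of an element \<open>x\<close> of order \<open>n\<close> carry
  the eigenfunction \<open>x [^] k \<mapsto> cis (2 * pi * k / n)\<close> of \<open>{x, inv x}\<close>; as \<open>2 * cos (2 * pi / n)\<close> is
  an integer only for \<open>n \<in> {1, 2, 3, 4, 6}\<close>, in odd order every element of a group in \<open>class_G3\<close>
  satisfies \<open>x [^] 3 = \<one>\<close>.

  For \<open>class_A3 \<subseteq> class_G3\<close> connection sets of size 2 have to be controlled by those of size 3.
  If an involution commutes with all of \<open>S\<close>, it can be dropped from \<open>insert t S\<close>. Using the sets
  \<open>{a, b, (a \<otimes> b) [^] (n div 2)}\<close> and \<open>{a, b, a \<otimes> b \<otimes> a}\<close>, a product of two involutions has order at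
  most 3. It follows that either all involutions commute or there are exactly three of them,
  generating a symmetric group. In both cases the normal subgroup \<open>M\<close> generated by the involutions
  is explicit. For \<open>x\<close> of odd order, \<open>{x, inv x, t}\<close> acts on functions on \<open>G/M\<close> as \<open>x + inv x + 1\<close>,
  whence \<open>x [^] 3 \<in> M\<close> and then \<open>x [^] 3 = \<one>\<close>.\<close>

section \<open>Eigenfunctions of Cayley graphs\<close>

text \<open>Comparison with the angles 0, pi/3 and pi/2 places the value strictly between 0 and 1
  for \<open>n = 5\<close> and strictly between 1 and 2 for \<open>n \<ge> 7\<close>.\<close>

lemma two_cos_int_imp:
  assumes n: "n > 0" and int: "2 * cos (2 * pi / real n) \<in> \<int>"
  shows "n \<in> {1, 2, 3, 4, 6}"
proof (rule ccontr)
  assume nn: "n \<notin> {1, 2, 3, 4, 6}"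
  then have "n = 5 \<or> n \<ge> 7" using n by force
  then show False
  proof
    assume "n = 5"
    have "cos (2 * pi / 5) < cos (pi / 3)"
      by (rule cos_monotone_0_pi) (auto simp: field_simps)
    moreover have "cos (2 * pi / 5) > 0"
      by (rule cos_gt_zero_pi) (auto simp: field_simps)
    ultimately have "0 < 2 * cos (2 * pi / 5)" "2 * cos (2 * pi / 5) < 1"
      by (auto simp: cos_60)
    moreover obtain k :: int where "2 * cos (2 * pi / 5) = of_int k"
      using int \<open>n = 5\<close> by (auto elim: Ints_cases)
    ultimately show False by simp
  next
    assume "n \<ge> 7"
    then have n7: "real n \<ge> 7" by simp
    have "2 * pi / real n < pi / 3"
      using n7 pi_gt_zero by (simp add: field_simps)
    then have "cos (pi / 3) < cos (2 * pi / real n)"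
      using n7 by (intro cos_monotone_0_pi) auto
    moreover have "cos (2 * pi / real n) < cos 0"
      using n7 pi_gt_zero by (intro cos_monotone_0_pi) (auto simp: field_simps)
    ultimately have "1 < 2 * cos (2 * pi / real n)" "2 * cos (2 * pi / real n) < 2"
      by (auto simp: cos_60)
    moreover obtain k :: int where "2 * cos (2 * pi / real n) = of_int k"
      using int by (auto elim: Ints_cases)
    ultimately show False by simp
  qed
qed

lemma cis_add_inverse: "cis t + inverse (cis t) = complex_of_real (2 * cos t)"
  by (simp add: complex_eq_iff)

lemma prime_3: "prime (3::nat)"
  by simp

lemma power_if_only_prime_factor:
  fixes n :: nat
  assumes n: "n > 0" and "prime p" and only: "\<And>q. prime q \<Longrightarrow> q dvd n \<Longrightarrow> q = p"
  shows "\<exists>k. n = p ^ k"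
proof -
  obtain m where m: "n = p ^ multiplicity p n * m" "\<not> p dvd m"
    using multiplicity_decompose'[of n p] n \<open>prime p\<close> by (metis less_numeral_extra(3) not_prime_unit)
  have "m = 1"
  proof (rule ccontr)
    assume "m \<noteq> 1"
    then obtain q where q: "prime q" "q dvd m" using prime_factor_nat by blast
    then have "q = p" using only[of q] m(1) by (metis dvd_mult)
    then show False using q m(2) by simp
  qed
  then show ?thesis using m(1) by auto
qed

section \<open>From adjacency matrices to functions on the group\<close>

locale finite_group = group +
  assumes finite_carrier: "finite (carrier G)"
begin

text \<open>Integrality of the spectrum, freed from a listing of the vertices. Values of
  \<open>f\<close> off the carrier are arbitrary, so a nonzero value is demanded on it.\<close>

definition integral_set :: "'a set \<Rightarrow> bool" where
  "integral_set S \<longleftrightarrow>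
     (\<forall>(f :: 'a \<Rightarrow> complex) k. (\<exists>g\<in>carrier G. f g \<noteq> 0) \<longrightarrow>
        (\<forall>g\<in>carrier G. (\<Sum>s\<in>S. f (s \<otimes> g)) = k * f g) \<longrightarrow> k \<in> \<int>)"

lemma integral_setI:
  assumes "\<And>(f :: 'a \<Rightarrow> complex) k g. g \<in> carrier G \<Longrightarrow> f g \<noteq> 0 \<Longrightarrow>
    (\<And>h. h \<in> carrier G \<Longrightarrow> (\<Sum>s\<in>S. f (s \<otimes> h)) = k * f h) \<Longrightarrow> k \<in> \<int>"
  shows "integral_set S"
  using assms unfolding integral_set_def by blast

lemma integral_setD:
  fixes f :: "'a \<Rightarrow> complex"
  assumes "integral_set S" "g \<in> carrier G" "f g \<noteq> 0"
    and "\<And>h. h \<in> carrier G \<Longrightarrow> (\<Sum>s\<in>S. f (s \<otimes> h)) = k * f h"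
  shows "k \<in> \<int>"
  using assms unfolding integral_set_def by blast

text \<open>An edge does not tell which of its ends is multiplied by \<open>s\<close>; closure of
  \<open>S\<close> under inverses makes both readings agree.\<close>

lemma edge_Cay_iff:
  assumes S: "connection_set G S" and g: "g \<in> carrier G" "h \<in> carrier G"
  shows "{g, h} \<in> snd (Cay G S) \<longleftrightarrow> h \<otimes> inv g \<in> S"
proof
  assume "{g, h} \<in> snd (Cay G S)"
  then obtain g' s where e: "{g, h} = {g', s \<otimes> g'}" "g' \<in> carrier G" "s \<in> S"
    by (auto simp: Cay_def)
  have s: "s \<in> carrier G" "inv s \<in> S"
    using S e(3) unfolding connection_set_def by auto
  consider "g = g'" "h = s \<otimes> g'" | "h = g'" "g = s \<otimes> g'"
    using e(1) by (auto simp: doubleton_eq_iff)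
  then show "h \<otimes> inv g \<in> S"
  proof cases
    case 1
    then show ?thesis using e s by (simp add: m_assoc)
  next
    case 2
    then show ?thesis using e s by (simp add: inv_mult_group m_assoc[symmetric])
  qed
next
  assume "h \<otimes> inv g \<in> S"
  moreover have "h = (h \<otimes> inv g) \<otimes> g"
    using g by (simp add: m_assoc)
  ultimately show "{g, h} \<in> snd (Cay G S)"
    using g unfolding Cay_def snd_conv by (metis (mono_tags, lifting) mem_Collect_eq)
qed

lemma sum_right_translate:
  fixes f :: "'a \<Rightarrow> complex"
  assumes S: "S \<subseteq> carrier G" and g: "g \<in> carrier G"
  shows "(\<Sum>h\<in>carrier G. if h \<otimes> inv g \<in> S then f h else 0) = (\<Sum>s\<in>S. f (s \<otimes> g))"
proof -
  have "(\<Sum>h\<in>carrier G. if h \<otimes> inv g \<in> S then f h else 0)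
      = (\<Sum>h\<in>{h\<in>carrier G. h \<otimes> inv g \<in> S}. f h)"
    using finite_carrier by (simp add: sum.inter_filter)
  also have "\<dots> = (\<Sum>s\<in>S. f (s \<otimes> g))"
    by (rule sum.reindex_bij_witness[of _ "\<lambda>s. s \<otimes> g" "\<lambda>h. h \<otimes> inv g"])
      (use S g in \<open>auto simp: m_assoc subset_iff\<close>)
  finally show ?thesis .
qed

text \<open>A listing of the carrier turns functions on the group into vectors. The row of
  \<open>A\<close> at \<open>g\<close> selects the \<open>h\<close> with
  \<open>h \<otimes> inv g \<in> S\<close>, that is \<open>h = s \<otimes> g\<close>, so applying
  \<open>A\<close> sums over \<open>S\<close>.\<close>

lemma spectrum_Cay_iff:
  assumes S: "connection_set G S" and vs: "distinct vs" "set vs = carrier G"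
  shows "spectrum (adjacency_matrix vs (snd (Cay G S))) \<subseteq> \<int> \<longleftrightarrow> integral_set S"
proof -
  define n where "n = length vs"
  define A where "A = adjacency_matrix vs (snd (Cay G S))"
  have A: "A \<in> carrier_mat n n" "dim_row A = n" "dim_col A = n"
    by (auto simp: A_def adjacency_matrix_def n_def)
  have SG: "S \<subseteq> carrier G" using S by (simp add: connection_set_def)
  have vsG: "i < n \<Longrightarrow> vs ! i \<in> carrier G" for i
    using vs(2) nth_mem unfolding n_def by blast
  have bij: "bij_betw (\<lambda>i. vs ! i) {0..<n} (carrier G)"
    unfolding n_def by (rule bij_betw_nth) (use vs in \<open>auto simp: atLeast0LessThan\<close>)
  have mult: "(A *\<^sub>v vec n (\<lambda>i. f (vs ! i))) $ i = (\<Sum>s\<in>S. f (s \<otimes> vs ! i))"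
    if "i < n" for f :: "'a \<Rightarrow> complex" and i
  proof -
    have "(A *\<^sub>v vec n (\<lambda>i. f (vs ! i))) $ i
        = (\<Sum>j\<in>{0..<n}. if vs ! j \<otimes> inv (vs ! i) \<in> S then f (vs ! j) else 0)"
      using that A vsG S
      by (auto simp: scalar_prod_def A_def adjacency_matrix_def n_def edge_Cay_iff intro!: sum.cong)
    also have "\<dots> = (\<Sum>h\<in>carrier G. if h \<otimes> inv (vs ! i) \<in> S then f h else 0)"
      by (rule sum.reindex_bij_betw[OF bij])
    also have "\<dots> = (\<Sum>s\<in>S. f (s \<otimes> vs ! i))"
      by (rule sum_right_translate[OF SG vsG[OF that]])
    finally show ?thesis .
  qed
  have eigen: "eigenvector A (vec n (\<lambda>i. f (vs ! i))) k \<longleftrightarrow>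
      (\<exists>g\<in>carrier G. f g \<noteq> 0) \<and> (\<forall>g\<in>carrier G. (\<Sum>s\<in>S. f (s \<otimes> g)) = k * f g)"
    for f :: "'a \<Rightarrow> complex" and k
  proof -
    have G: "(\<forall>g\<in>carrier G. P g) \<longleftrightarrow> (\<forall>i<n. P (vs ! i))"
            "(\<exists>g\<in>carrier G. P g) \<longleftrightarrow> (\<exists>i<n. P (vs ! i))" for P
      using vs by (metis (full_types) in_set_conv_nth n_def)+
    show ?thesis
      unfolding eigenvector_def G using A mult by (auto simp: vec_eq_iff)
  qed
  \<comment> \<open>Every vector comes from a function: \<open>f g\<close> is the coordinate of
    \<open>v\<close> at the position of \<open>g\<close> in the listing.\<close>
  have "\<exists>f. v = vec n (\<lambda>i. f (vs ! i))" if "v \<in> carrier_vec n" for v :: "complex vec"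
  proof (intro exI eq_vecI)
    define f where "f = (\<lambda>g. v $ (inv_into {0..<n} (\<lambda>i. vs ! i) g))"
    show "v $ i = vec n (\<lambda>i. f (vs ! i)) $ i" if "i < dim_vec (vec n (\<lambda>i. f (vs ! i)))" for i
      using that bij_betw_inv_into_left[OF bij, of i] by (simp add: f_def)
  qed (use that in auto)
  then have "eigenvalue A k \<longleftrightarrow> (\<exists>f. eigenvector A (vec n (\<lambda>i. f (vs ! i))) k)" for k
    unfolding eigenvalue_def using A by (metis eigenvector_def)
  then show ?thesis
    unfolding A_def[symmetric] spectrum_def integral_set_def eigen by blast
qed

lemma integral_graph_Cay_iff:
  assumes "connection_set G S"
  shows "integral_graph (Cay G S) \<longleftrightarrow> integral_set S"
proof -
  obtain vs where "distinct vs" "set vs = carrier G"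
    using finite_distinct_list[OF finite_carrier] by blast
  moreover have "fst (Cay G S) = carrier G"
    by (simp add: Cay_def)
  ultimately show ?thesis
    unfolding integral_graph_def using spectrum_Cay_iff[OF assms] by metis
qed

section \<open>Eigenfunctions from cyclic subgroups and quotients\<close>

lemma ord_pos: "x \<in> carrier G \<Longrightarrow> ord x > 0"
  using finite_carrier ord_ge_1 by force

text \<open>The function is a character of the cyclic subgroup generated by \<open>x\<close>,
  extended by zero. Left multiplication by \<open>x\<close> preserves both this subgroup and its
  complement.\<close>

lemma exists_cyclic_eigenfunction:
  assumes x: "x \<in> carrier G"
  obtains f :: "'a \<Rightarrow> complex" where
    "f \<one> = 1" "\<And>g. g \<in> carrier G \<Longrightarrow> f (x \<otimes> g) = cis (2 * pi / real (ord x)) * f g"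
proof -
  define z where "z = cis (2 * pi / real (ord x))"
  have zn: "z ^ ord x = 1"
    using ord_pos[OF x] by (simp add: z_def DeMoivre)
  \<comment> \<open>The values of \<open>f\<close> below do not depend on the chosen exponent. The
    order of \<open>j\<close> and \<open>k\<close> matters because their difference is taken in the
    naturals.\<close>
  have le: "z ^ k = z ^ j" if eq: "x [^] k = x [^] j" and "j \<le> k" for k j :: nat
  proof -
    have "ord x dvd k - j"
      using pow_eq_div2[OF x eq] pow_eq_id[OF x] by simp
    then obtain m where "k = j + ord x * m"
      using \<open>j \<le> k\<close> by (metis dvdE le_add_diff_inverse)
    then show ?thesis by (simp add: power_add power_mult zn)
  qed
  have eq: "z ^ k = z ^ j" if "x [^] k = x [^] j" for k j :: nat
    using le[of k j] le[of j k] that by (metis nat_le_linear)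
  define f where
    "f g = (if \<exists>k::nat. g = x [^] k then z ^ (SOME k::nat. g = x [^] k) else 0)" for g
  have f: "f (x [^] k) = z ^ k" for k :: nat
    using eq[of "SOME j. x [^] k = x [^] j" k] someI[of "\<lambda>j. x [^] k = x [^] j" k]
    by (auto simp: f_def)
  have Suc: "x \<otimes> x [^] k = x [^] Suc k" for k :: nat
    by (rule nat_pow_Suc2[OF x, symmetric])
  have "f (x \<otimes> g) = z * f g" if g: "g \<in> carrier G" for g
  proof (cases "\<exists>k::nat. g = x [^] k")
    case True
    then show ?thesis using f Suc by (metis power_Suc)
  next
    case False
    have "\<nexists>k::nat. x \<otimes> g = x [^] k"
    proof
      assume "\<exists>k::nat. x \<otimes> g = x [^] k"
      then obtain k :: nat where "x \<otimes> g = x [^] k" by blast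
      \<comment> \<open>Raising the exponent by \<open>ord x\<close> lets a factor \<open>x\<close>
        be split off even if \<open>k = 0\<close>.\<close>
      moreover have "x [^] k = x [^] (k + ord x)"
        using x by (simp flip: nat_pow_mult)
      moreover have "x [^] (k + ord x) = x \<otimes> x [^] (k + ord x - 1)"
        using Suc[of "k + ord x - 1"] ord_pos[OF x] by simp
      ultimately have "g = x [^] (k + ord x - 1)"
        using x g by simp
      with False show False by blast
    qed
    with False show ?thesis by (simp add: f_def)
  qed
  moreover have "f \<one> = 1" using f[of 0] by simp
  ultimately show ?thesis using that unfolding z_def by blast
qed

text \<open>The eigenfunction belonging to the coset of \<open>x\<close> in \<open>G Mod M\<close>
  is pulled back to \<open>G\<close>, and \<open>n\<close> is the order of that coset. Being
  constant on cosets, the function ignores left factors from \<open>M\<close>.\<close>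

lemma exists_eigenfunction_mod:
  assumes M: "M \<lhd> G" and x: "x \<in> carrier G"
  obtains f :: "'a \<Rightarrow> complex" and n :: nat where
    "n > 0" "\<And>k::nat. x [^] k \<in> M \<longleftrightarrow> n dvd k" "f \<one> = 1"
    "\<And>g. g \<in> carrier G \<Longrightarrow> f (x \<otimes> g) = cis (2 * pi / real n) * f g"
    "\<And>g m. g \<in> carrier G \<Longrightarrow> m \<in> M \<Longrightarrow> f (m \<otimes> g) = f g"
proof -
  interpret M: normal M G by (rule M)
  interpret Q: group "G Mod M" by (rule M.factorgroup_is_group)
  interpret Q: finite_group "G Mod M"
    by unfold_locales (simp add: FactGroup_def RCOSETS_def finite_carrier)
  interpret h: group_hom G "G Mod M" "\<lambda>a. M #> a"
    by unfold_locales (rule M.r_coset_hom_Mod)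
  have y: "M #> x \<in> carrier (G Mod M)" using x by (rule h.hom_closed)
  obtain f :: "'a set \<Rightarrow> complex" where f: "f \<one>\<^bsub>G Mod M\<^esub> = 1"
    "\<And>g. g \<in> carrier (G Mod M) \<Longrightarrow>
      f ((M #> x) \<otimes>\<^bsub>G Mod M\<^esub> g) = cis (2 * pi / real (Q.ord (M #> x))) * f g"
    using Q.exists_cyclic_eigenfunction[OF y] by blast
  have mem: "g \<in> M \<longleftrightarrow> M #> g = \<one>\<^bsub>G Mod M\<^esub>" if "g \<in> carrier G" for g
    using that M.rcos_const coset_join1[OF _ that M.subgroup_axioms]
    by (auto simp: M.is_subgroup M.subset)
  show ?thesis
  proof (rule that[of "Q.ord (M #> x)" "\<lambda>g. f (M #> g)"])
    show "Q.ord (M #> x) > 0" by (rule Q.ord_pos[OF y])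
    show "x [^] k \<in> M \<longleftrightarrow> Q.ord (M #> x) dvd k" for k :: nat
      unfolding mem[OF nat_pow_closed[OF x]] h.hom_nat_pow[OF x] Q.pow_eq_id[OF y] ..
    show "f (M #> \<one>) = 1" using f(1) h.hom_one by simp
    show "f (M #> (x \<otimes> g)) = cis (2 * pi / real (Q.ord (M #> x))) * f (M #> g)"
      if "g \<in> carrier G" for g
      using that x f(2) h.hom_mult h.hom_closed by simp
    show "f (M #> (m \<otimes> g)) = f (M #> g)" if "g \<in> carrier G" "m \<in> M" for g m
      using coset_mult_assoc[OF M.subset subsetD[OF M.subset that(2)] that(1)]
        M.rcos_const[OF is_group that(2)] by simp
  qed
qed

section \<open>Transfer of integrality between connection sets and orders\<close>

text \<open>Under the commuting involution, a \<open>k\<close>-eigenfunction of \<open>S\<close> splits into a symmetric and an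
  antisymmetric part, with eigenvalues \<open>k + 1\<close> and \<open>k - 1\<close> for \<open>insert t S\<close>.\<close>

lemma integral_set_remove_commuting_involution:
  assumes int: "integral_set (insert t S)" and S: "S \<subseteq> carrier G" "t \<notin> S"
    and t: "t \<in> carrier G" "t \<otimes> t = \<one>" "\<And>s. s \<in> S \<Longrightarrow> s \<otimes> t = t \<otimes> s"
  shows "integral_set S"
proof (rule integral_setI)
  fix f :: "'a \<Rightarrow> complex" and k g
  assume g: "g \<in> carrier G" "f g \<noteq> 0"
    and f: "\<And>h. h \<in> carrier G \<Longrightarrow> (\<Sum>s\<in>S. f (s \<otimes> h)) = k * f h"
  have fin: "finite S" using S finite_carrier finite_subset by blast
  have split: "k \<in> \<int>" if e: "e * e = 1" "e \<in> \<int>" and nz: "f g + e * f (t \<otimes> g) \<noteq> 0" for e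
  proof -
    have "k + e \<in> \<int>"
    proof (rule integral_setD[where f = "\<lambda>g. f g + e * f (t \<otimes> g)", OF int g(1) nz])
      fix h assume h: "h \<in> carrier G"
      have tt: "t \<otimes> (t \<otimes> h) = h"
        using t h by (simp flip: m_assoc)
      have st: "t \<otimes> (s \<otimes> h) = s \<otimes> (t \<otimes> h)" if "s \<in> S" for s
        using t(1) t(3)[OF that] h subsetD[OF S(1) that] by (simp flip: m_assoc)
      have "(\<Sum>s\<in>S. f (s \<otimes> h) + e * f (t \<otimes> (s \<otimes> h)))
          = (\<Sum>s\<in>S. f (s \<otimes> h)) + e * (\<Sum>s\<in>S. f (s \<otimes> (t \<otimes> h)))"
        by (simp add: sum.distrib sum_distrib_left st)
      also have "\<dots> = k * f h + e * (k * f (t \<otimes> h))"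
        using f h t by simp
      finally show "(\<Sum>s\<in>insert t S. f (s \<otimes> h) + e * f (t \<otimes> (s \<otimes> h)))
          = (k + e) * (f h + e * f (t \<otimes> h))"
        using fin S(2) tt e(1) by (simp add: algebra_simps)
    qed
    then show ?thesis using e(2) Ints_diff by fastforce
  qed
  show "k \<in> \<int>"
  proof (cases "f g + f (t \<otimes> g) = 0")
    case False
    then show ?thesis using split[of 1] by simp
  next
    case True
    then have "f g + (-1) * f (t \<otimes> g) \<noteq> 0"
      using g(2) by (simp add: eq_neg_iff_add_eq_0[symmetric])
    then show ?thesis using split[of "-1"] by simp
  qed
qed

text \<open>Let A be the operator of \<open>S\<close>, so that A^2 f = m^2 f. Either (A + m) f
  vanishes and \<open>f\<close> has eigenvalue \<open>- m\<close>, or (A + m) f is an eigenfunction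
  with eigenvalue \<open>m\<close>. This spares finding an eigenfunction of A itself.\<close>

lemma integral_set_square:
  fixes f :: "'a \<Rightarrow> complex"
  assumes int: "integral_set S" and S: "S \<subseteq> carrier G" and g: "g \<in> carrier G" "f g \<noteq> 0"
    and f: "\<And>h. h \<in> carrier G \<Longrightarrow> (\<Sum>s\<in>S. \<Sum>s'\<in>S. f (s' \<otimes> (s \<otimes> h))) = m\<^sup>2 * f h"
  shows "m \<in> \<int>"
proof (cases "\<forall>h\<in>carrier G. (\<Sum>s\<in>S. f (s \<otimes> h)) + m * f h = 0")
  case True
  have "- m \<in> \<int>"
    by (rule integral_setD[where f = f, OF int g]) (use True in \<open>simp add: eq_neg_iff_add_eq_0\<close>)
  then show ?thesis by simp
next
  case False
  then obtain g' where "g' \<in> carrier G" "(\<Sum>s\<in>S. f (s \<otimes> g')) + m * f g' \<noteq> 0" by blast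
  then show ?thesis
  proof (rule integral_setD[where f = "\<lambda>h. (\<Sum>s\<in>S. f (s \<otimes> h)) + m * f h", OF int])
    fix h assume h: "h \<in> carrier G"
    show "(\<Sum>s\<in>S. (\<Sum>s'\<in>S. f (s' \<otimes> (s \<otimes> h))) + m * f (s \<otimes> h))
        = m * ((\<Sum>s\<in>S. f (s \<otimes> h)) + m * f h)"
      using f[OF h] by (simp add: sum.distrib sum_distrib_left[symmetric] algebra_simps power2_eq_square)
  qed
qed

lemma integral_inverse_pair_imp:
  assumes int: "integral_set {x, inv x}" and x: "x \<in> carrier G" "x \<noteq> inv x"
  shows "ord x \<in> {1, 2, 3, 4, 6}"
proof -
  obtain f :: "'a \<Rightarrow> complex" where f: "f \<one> = 1"
    "\<And>g. g \<in> carrier G \<Longrightarrow> f (x \<otimes> g) = cis (2 * pi / real (ord x)) * f g"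
    using exists_cyclic_eigenfunction[OF x(1)] by blast
  let ?z = "cis (2 * pi / real (ord x))"
  have inv: "f (inv x \<otimes> g) = inverse ?z * f g" if g: "g \<in> carrier G" for g
    using f(2)[of "inv x \<otimes> g"] x g by (simp flip: m_assoc add: field_simps)
  have "?z + inverse ?z \<in> \<int>"
    by (rule integral_setD[where f = f, OF int, of \<one>]) (use f inv x in \<open>auto simp: algebra_simps\<close>)
  then show ?thesis
    unfolding cis_add_inverse of_real_in_Ints_iff by (rule two_cos_int_imp[OF ord_pos[OF x(1)]])
qed

text \<open>On a function pulled back from \<open>G Mod M\<close> the element \<open>t\<close> acts
  trivially, so the eigenvalue is 1 + 2 cos (2 pi / n) with \<open>n\<close> the order of
  \<open>x\<close> modulo \<open>M\<close>. As \<open>n\<close> divides the odd number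
  \<open>ord x\<close>, only 1 and 3 remain.\<close>

lemma odd_order_cube_mem:
  assumes M: "M \<lhd> G" and x: "x \<in> carrier G" "odd (ord x)" "x \<noteq> inv x"
    and t: "t \<in> M" "t \<noteq> x" "t \<noteq> inv x"
    and int: "integral_set {x, inv x, t}"
  shows "x [^] (3::nat) \<in> M"
proof -
  obtain f :: "'a \<Rightarrow> complex" and n where n: "n > 0" "\<And>k::nat. x [^] k \<in> M \<longleftrightarrow> n dvd k"
    and f: "f \<one> = 1" "\<And>g. g \<in> carrier G \<Longrightarrow> f (x \<otimes> g) = cis (2 * pi / real n) * f g"
    "\<And>g m. g \<in> carrier G \<Longrightarrow> m \<in> M \<Longrightarrow> f (m \<otimes> g) = f g"
    using exists_eigenfunction_mod[OF M x(1)] by metis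
  let ?z = "cis (2 * pi / real n)"
  have inv: "f (inv x \<otimes> g) = inverse ?z * f g" if g: "g \<in> carrier G" for g
    using f(2)[of "inv x \<otimes> g"] x g by (simp flip: m_assoc add: field_simps)
  have "1 + (?z + inverse ?z) \<in> \<int>"
    by (rule integral_setD[where f = f, OF int, of \<one>])
      (use f inv x t in \<open>auto simp: algebra_simps\<close>)
  then have "complex_of_real (1 + 2 * cos (2 * pi / real n)) \<in> \<int>"
    unfolding cis_add_inverse by simp
  then have "1 + 2 * cos (2 * pi / real n) - 1 \<in> \<int>"
    by (intro Ints_diff) (simp_all only: of_real_in_Ints_iff Ints_1)
  then have "n \<in> {1, 2, 3, 4, 6}"
    using n(1) by (intro two_cos_int_imp) auto
  moreover have "n dvd ord x"
    using n(2)[of "ord x"] x(1) M by (simp add: normal_imp_subgroup subgroup.one_closed)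
  then have "odd n" using x(2) by (meson dvd_trans)
  ultimately have "n = 1 \<or> n = 3" by auto
  then show ?thesis using n(2)[of 3] by fastforce
qed

section \<open>Products of involutions\<close>

definition involution :: "'a \<Rightarrow> bool" where
  "involution t \<longleftrightarrow> t \<in> carrier G \<and> t \<noteq> \<one> \<and> t \<otimes> t = \<one>"

lemma involution_closed [simp]: "involution t \<Longrightarrow> t \<in> carrier G"
  by (simp add: involution_def)

lemma involution_square: "involution t \<Longrightarrow> t \<otimes> t = \<one>"
  by (simp add: involution_def)

lemma involution_cancel: "involution t \<Longrightarrow> x \<in> carrier G \<Longrightarrow> t \<otimes> (t \<otimes> x) = x"
  by (simp add: involution_def flip: m_assoc)

lemma involution_inv: "involution t \<Longrightarrow> inv t = t"
  by (simp add: involution_def inv_equality)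

lemma involution_conj:
  assumes "involution t" "x \<in> carrier G"
  shows "involution (x \<otimes> t \<otimes> inv x)"
proof -
  have "x \<otimes> t \<otimes> inv x \<otimes> (x \<otimes> t \<otimes> inv x) = x \<otimes> (t \<otimes> t) \<otimes> inv x"
    using assms by (simp add: m_assoc inv_solve_left')
  moreover have "x \<otimes> t \<otimes> inv x \<noteq> \<one>"
    using assms by (auto simp: involution_def inv_solve_right')
  ultimately show ?thesis
    using assms by (simp add: involution_def)
qed

lemma involution_mult_commuting:
  assumes "involution a" "involution b" "a \<noteq> b" "a \<otimes> b = b \<otimes> a"
  shows "involution (a \<otimes> b)"
proof -
  have "a \<otimes> b \<otimes> (a \<otimes> b) = a \<otimes> b \<otimes> (b \<otimes> a)"
    using assms(4) by simp
  also have "\<dots> = \<one>"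
    using assms(1,2) by (simp add: m_assoc involution_cancel involution_square)
  finally have "a \<otimes> b \<otimes> (a \<otimes> b) = \<one>" .
  moreover have "a \<otimes> b \<noteq> \<one>"
    using assms(1-3) involution_inv[of a] involution_inv[of b] inv_equality[of a b] by auto
  ultimately show ?thesis
    using assms(1,2) by (simp add: involution_def)
qed

lemma involution_mult_cube_imp:
  assumes "involution a" "involution b" "(a \<otimes> b) [^] (3::nat) = \<one>"
  shows "a \<otimes> (b \<otimes> a) = b \<otimes> (a \<otimes> b)"
proof -
  have "a \<otimes> (b \<otimes> (a \<otimes> (b \<otimes> (a \<otimes> b)))) = \<one>"
    using assms by (simp add: numeral_3_eq_3 m_assoc)
  \<comment> \<open>The word aba followed by the trivial word ababab collapses from the middle to
    bab.\<close>
  then have "a \<otimes> (b \<otimes> (a \<otimes> (a \<otimes> (b \<otimes> (a \<otimes> (b \<otimes> (a \<otimes> b))))))) = a \<otimes> (b \<otimes> a)"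
    using assms(1,2) by simp
  then show ?thesis
    using assms(1,2) by (simp add: involution_cancel)
qed

lemma braid_imp_cube:
  assumes "involution a" "involution b" "a \<otimes> (b \<otimes> a) = b \<otimes> (a \<otimes> b)"
  shows "(a \<otimes> b) [^] (3::nat) = \<one>"
proof -
  have "(a \<otimes> b) [^] (3::nat) = a \<otimes> (b \<otimes> a) \<otimes> (b \<otimes> (a \<otimes> b))"
    using assms(1,2) by (simp add: numeral_3_eq_3 m_assoc)
  also have "\<dots> = \<one>"
    unfolding assms(3) using assms(1,2) by (simp add: m_assoc involution_cancel involution_square)
  finally show ?thesis .
qed

text \<open>With products nested to the right, the braid relation needs a tail \<open>x\<close> to
  be applicable inside a longer word.\<close>

lemma braid_tail:
  assumes "a \<otimes> (b \<otimes> a) = b \<otimes> (a \<otimes> b)" "a \<in> carrier G" "b \<in> carrier G" "x \<in> carrier G"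
  shows "a \<otimes> (b \<otimes> (a \<otimes> x)) = b \<otimes> (a \<otimes> (b \<otimes> x))"
proof -
  have "a \<otimes> (b \<otimes> a) \<otimes> x = b \<otimes> (a \<otimes> b) \<otimes> x"
    using assms(1) by simp
  then show ?thesis
    using assms(2-) by (simp add: m_assoc)
qed

text \<open>The dihedral relation: conjugation by \<open>a\<close> turns the rotation
  \<open>a \<otimes> b\<close> into its inverse \<open>b \<otimes> a\<close>.\<close>

lemma involution_pow_inverts:
  assumes "involution a" "involution b"
  shows "a \<otimes> (a \<otimes> b) [^] (k::nat) = inv ((a \<otimes> b) [^] k) \<otimes> a"
proof -
  have inv: "inv (a \<otimes> b) = b \<otimes> a"
    using assms by (simp add: inv_mult_group involution_inv)
  have "a \<otimes> (a \<otimes> b) [^] k = (b \<otimes> a) [^] k \<otimes> a"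
  proof (induction k)
    case (Suc k)
    have "a \<otimes> (a \<otimes> b) [^] Suc k = a \<otimes> (a \<otimes> b) [^] k \<otimes> (a \<otimes> b)"
      using assms by (simp add: m_assoc)
    also have "\<dots> = (b \<otimes> a) [^] Suc k \<otimes> a"
      unfolding Suc using assms by (simp add: m_assoc involution_cancel involution_square)
    finally show ?case .
  qed (use assms in simp)
  then show ?thesis
    using assms by (simp add: nat_pow_inv inv flip: inv)
qed

end

text \<open>This is \<open>class_A3\<close> without the parity of the order; where it matters, an
  involution appears as a hypothesis instead.\<close>

locale cubic_integral_group = finite_group +
  assumes cubic_integral: "connection_set G S \<Longrightarrow> card S = 3 \<Longrightarrow> integral_set S"
begin

section \<open>The order of a product of two involutions\<close>

lemma integral_set_involutions:
  assumes "involution a" "involution b" "involution c" "a \<noteq> b" "a \<noteq> c" "b \<noteq> c"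
  shows "integral_set {a, b, c}"
  by (rule cubic_integral)
    (use assms in \<open>auto simp: connection_set_def involution_inv involution_def\<close>)

lemma involutions_eigenfunction:
  assumes a: "involution a" and b: "involution b"
  obtains f :: "'a \<Rightarrow> complex" where "f \<one> = 1"
    "\<And>g. g \<in> carrier G \<Longrightarrow> f (a \<otimes> (b \<otimes> g)) = cis (2 * pi / real (ord (a \<otimes> b))) * f g"
    "\<And>g. g \<in> carrier G \<Longrightarrow> f (b \<otimes> (a \<otimes> g)) = inverse (cis (2 * pi / real (ord (a \<otimes> b)))) * f g"
proof -
  have ab: "a \<in> carrier G" "b \<in> carrier G" using a b by auto
  obtain f :: "'a \<Rightarrow> complex" where f: "f \<one> = 1"
    "\<And>g. g \<in> carrier G \<Longrightarrow> f (a \<otimes> b \<otimes> g) = cis (2 * pi / real (ord (a \<otimes> b))) * f g"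
    using exists_cyclic_eigenfunction[of "a \<otimes> b"] ab by auto
  have 1: "f (a \<otimes> (b \<otimes> g)) = cis (2 * pi / real (ord (a \<otimes> b))) * f g" if "g \<in> carrier G" for g
    using f(2)[OF that] ab that by (simp add: m_assoc)
  have "f (b \<otimes> (a \<otimes> g)) = inverse (cis (2 * pi / real (ord (a \<otimes> b)))) * f g"
    if "g \<in> carrier G" for g
    using 1[of "b \<otimes> (a \<otimes> g)"] that a b ab by (simp add: involution_cancel field_simps)
  with f(1) 1 show ?thesis using that by blast
qed

text \<open>The third involution is \<open>d\<close>, the conjugate of \<open>b\<close> by
  \<open>a\<close>. The nine products of two members of \<open>{a, b, d}\<close> are powers of the
  rotation \<open>a \<otimes> b\<close>, and on its eigenfunction with eigenvalue \<open>z\<close>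
  they add up to 3 + 2 (z + 1/z) + z^2 + 1/z^2, the square of 1 + z + 1/z. Thus 2 cos (2 pi / n) is
  an integer, and the odd order \<open>n\<close> must be 3.\<close>

lemma odd_order_involution_mult:
  assumes a: "involution a" and b: "involution b"
    and ne: "a \<otimes> b \<noteq> b \<otimes> a" and odd: "odd (ord (a \<otimes> b))"
  shows "a \<otimes> (b \<otimes> a) = b \<otimes> (a \<otimes> b)"
proof -
  have ab: "a \<in> carrier G" "b \<in> carrier G" using a b by auto
  define d where "d = a \<otimes> (b \<otimes> a)"
  have d: "involution d"
    using involution_conj[OF b ab(1)] a ab by (simp add: d_def involution_inv m_assoc)
  have dist: "a \<noteq> b" "a \<noteq> d" "b \<noteq> d"
  proof -
    show "a \<noteq> b" using ne by auto
    show "a \<noteq> d"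
    proof
      assume "a = d"
      then have "b \<otimes> a = \<one>" using ab by (simp add: d_def)
      then have "b = a" using ab inv_equality involution_inv[OF a] by metis
      then show False using ne by simp
    qed
    show "b \<noteq> d"
    proof
      assume "b = d"
      then have "a \<otimes> b = a \<otimes> (a \<otimes> (b \<otimes> a))" by (simp add: d_def)
      then have "a \<otimes> b = b \<otimes> a" using a ab by (simp add: involution_cancel)
      then show False using ne by simp
    qed
  qed
  let ?n = "ord (a \<otimes> b)"
  define z where "z = cis (2 * pi / real ?n)"
  have z: "z \<noteq> 0" by (simp add: z_def)
  obtain f :: "'a \<Rightarrow> complex" where f: "f \<one> = 1"
    "\<And>g. g \<in> carrier G \<Longrightarrow> f (a \<otimes> (b \<otimes> g)) = z * f g"
    "\<And>g. g \<in> carrier G \<Longrightarrow> f (b \<otimes> (a \<otimes> g)) = inverse z * f g"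
    using involutions_eigenfunction[OF a b] unfolding z_def by blast
  have "1 + (z + inverse z) \<in> \<int>"
  proof (rule integral_set_square[where f = f and g = \<one>])
    show "integral_set {a, b, d}"
      by (rule integral_set_involutions[OF a b d dist])
    fix h assume h: "h \<in> carrier G"
    show "(\<Sum>s\<in>{a, b, d}. \<Sum>s'\<in>{a, b, d}. f (s' \<otimes> (s \<otimes> h))) = (1 + (z + inverse z))\<^sup>2 * f h"
      using dist h ab a b z
      by (simp add: d_def m_assoc involution_cancel f)
        (simp add: power2_eq_square algebra_simps)
  qed (use ab d f in auto)
  then have "complex_of_real (1 + 2 * cos (2 * pi / real ?n)) \<in> \<int>"
    unfolding z_def cis_add_inverse by simp
  then have "1 + 2 * cos (2 * pi / real ?n) - 1 \<in> \<int>"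
    by (intro Ints_diff) (simp_all only: of_real_in_Ints_iff Ints_1)
  then have "?n \<in> {1, 2, 3, 4, 6}"
    using ab by (intro two_cos_int_imp ord_pos) auto
  with odd have "3 dvd ?n \<or> ?n = 1" by auto
  moreover have "?n \<noteq> 1"
  proof
    assume "?n = 1"
    then have "a \<otimes> b = \<one>" using ab ord_eq_1 by blast
    then have "a = b" using ab inv_equality involution_inv[OF b] by metis
    then show False using ne by simp
  qed
  ultimately have "?n = 3" using \<open>?n \<in> {1, 2, 3, 4, 6}\<close> odd by auto
  then have "(a \<otimes> b) [^] (3::nat) = \<one>"
    using ab pow_ord_eq_1[of "a \<otimes> b"] by simp
  then show ?thesis by (rule involution_mult_cube_imp[OF a b])
qed

lemma even_order_involution_mult:
  assumes a: "involution a" and b: "involution b" and even: "even (ord (a \<otimes> b))"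
  shows "a \<otimes> b = b \<otimes> a"
proof (rule ccontr)
  assume ne: "a \<otimes> b \<noteq> b \<otimes> a"
  have ab: "a \<in> carrier G" "b \<in> carrier G" using a b by auto
  let ?n = "ord (a \<otimes> b)"
  let ?z = "cis (2 * pi / real ?n)"
  have npos: "?n > 0" using ab by (intro ord_pos) auto
  define k where "k = ?n div 2"
  have n: "?n = k + k" "k > 0" using even npos unfolding k_def by presburger+
  define c where "c = (a \<otimes> b) [^] k"
  have cG: "c \<in> carrier G" using ab by (simp add: c_def)
  have "c \<otimes> c = \<one>"
    using ab n(1) pow_ord_eq_1[of "a \<otimes> b"] by (simp add: c_def nat_pow_mult)
  moreover have "c \<noteq> \<one>"
  proof
    assume "c = \<one>"
    then have "?n dvd k" using ab pow_eq_id unfolding c_def by blast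
    then have "?n \<le> k" using n(2) by (rule dvd_imp_le)
    then show False using n by simp
  qed
  ultimately have c: "involution c" using cG by (simp add: involution_def)
  have ca: "a \<otimes> c = c \<otimes> a"
    using involution_pow_inverts[OF a b, of k] involution_inv[OF c] by (simp add: c_def)
  have cr: "c \<otimes> (a \<otimes> b) = a \<otimes> b \<otimes> c"
    using nat_pow_Suc2[of "a \<otimes> b" k] ab by (simp add: c_def)
  have "a \<otimes> (b \<otimes> c) = a \<otimes> (c \<otimes> b)"
  proof -
    have "a \<otimes> (b \<otimes> c) = c \<otimes> (a \<otimes> b)" using cr ab cG by (simp add: m_assoc)
    also have "\<dots> = a \<otimes> (c \<otimes> b)" using ca ab cG by (simp flip: m_assoc)
    finally show ?thesis .
  qed
  then have cb: "b \<otimes> c = c \<otimes> b" using ab cG by simp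
  have "c \<noteq> a" "c \<noteq> b" using ne ca cb by auto
  moreover have "a \<noteq> b" using ne by auto
  ultimately have "integral_set {c, a, b}"
    by (intro integral_set_involutions a b c)
  then have int: "integral_set {a, b}"
  proof (rule integral_set_remove_commuting_involution)
    show "s \<otimes> c = c \<otimes> s" if "s \<in> {a, b}" for s
      using that ca cb by blast
  qed (use \<open>c \<noteq> a\<close> \<open>c \<noteq> b\<close> ab cG involution_square[OF c] in auto)
  obtain f :: "'a \<Rightarrow> complex" where f: "f \<one> = 1"
    "\<And>g. g \<in> carrier G \<Longrightarrow> f (a \<otimes> (b \<otimes> g)) = ?z * f g"
    "\<And>g. g \<in> carrier G \<Longrightarrow> f (b \<otimes> (a \<otimes> g)) = inverse ?z * f g"
    using involutions_eigenfunction[OF a b] by blast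
  \<comment> \<open>Halving the angle extracts the square root of 2 + z + 1/z, so that the
    integrality criterion applies to twice the order of the rotation.\<close>
  let ?m = "complex_of_real (2 * cos (2 * pi / real (2 * ?n)))"
  have eq: "(2 * cos (2 * pi / real (2 * ?n)))\<^sup>2 = 2 + 2 * cos (2 * pi / real ?n)"
    using cos_double_cos[of "2 * pi / real (2 * ?n)"] by (simp add: power_mult_distrib)
  have sq: "?m\<^sup>2 = 2 + (?z + inverse ?z)"
    unfolding cis_add_inverse of_real_power[symmetric] eq by simp
  have "?m \<in> \<int>"
  proof (rule integral_set_square[where f = f and g = \<one>, OF int])
    fix h assume h: "h \<in> carrier G"
    show "(\<Sum>s\<in>{a, b}. \<Sum>s'\<in>{a, b}. f (s' \<otimes> (s \<otimes> h))) = ?m\<^sup>2 * f h"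
      unfolding sq using \<open>a \<noteq> b\<close> h ab a b
      by (simp add: involution_cancel f algebra_simps)
  qed (use ab f in auto)
  then have "2 * ?n \<in> {1, 2, 3, 4, 6}"
    unfolding of_real_in_Ints_iff using npos by (intro two_cos_int_imp) auto
  then have "?n \<in> {1, 2, 3}" by auto
  with even have "?n = 2" by auto
  then have "k = 1" using n by simp
  then have "a \<otimes> b \<otimes> (a \<otimes> b) = \<one>" using \<open>c \<otimes> c = \<one>\<close> ab by (simp add: c_def)
  then have "a \<otimes> b = inv (a \<otimes> b)" using ab by (simp add: inv_equality)
  then show False using ne a b ab by (simp add: inv_mult_group involution_inv)
qed

section \<open>Commutation among three involutions\<close>

lemma involutions_cases:
  assumes "involution a" "involution b"
  shows "a \<otimes> b = b \<otimes> a \<or> a \<otimes> (b \<otimes> a) = b \<otimes> (a \<otimes> b)"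
  using assms odd_order_involution_mult even_order_involution_mult by blast

text \<open>Otherwise \<open>a\<close> and \<open>c\<close> braid. If
  \<open>e = a \<otimes> b\<close> commutes with \<open>c\<close>, cancelling \<open>b\<close> makes
  \<open>a\<close> commute with \<open>c\<close>; if \<open>e\<close> and \<open>c\<close> braid,
  moving the factors \<open>b\<close> to the end and comparing with the relation of \<open>a\<close>
  and \<open>c\<close> gives \<open>b = \<one>\<close>.\<close>

lemma commuting_involutions_aux:
  assumes a: "involution a" and b: "involution b" and c: "involution c"
    and "a \<noteq> b" and ab: "a \<otimes> b = b \<otimes> a" and bc: "b \<otimes> c = c \<otimes> b"
  shows "a \<otimes> c = c \<otimes> a"
proof (rule ccontr)
  assume ac: "a \<otimes> c \<noteq> c \<otimes> a"
  have G: "a \<in> carrier G" "b \<in> carrier G" "c \<in> carrier G" using a b c by auto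
  note canc = m_assoc involution_cancel[OF a] involution_cancel[OF b] involution_cancel[OF c]
    involution_square[OF a] involution_square[OF b] involution_square[OF c]
  have aca: "a \<otimes> (c \<otimes> a) = c \<otimes> (a \<otimes> c)"
    using involutions_cases[OF a c] ac by blast
  have ba': "b \<otimes> (a \<otimes> x) = a \<otimes> (b \<otimes> x)" if "x \<in> carrier G" for x
    using ab G that by (simp flip: m_assoc)
  have bc': "b \<otimes> (c \<otimes> x) = c \<otimes> (b \<otimes> x)" if "x \<in> carrier G" for x
    using bc G that by (simp flip: m_assoc)
  define e where "e = a \<otimes> b"
  have e: "involution e" unfolding e_def by (rule involution_mult_commuting) fact+
  show False
    using involutions_cases[OF e c]
  proof
    assume "e \<otimes> c = c \<otimes> e"
    then have "a \<otimes> c \<otimes> b = c \<otimes> a \<otimes> b"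
      using G bc by (simp add: e_def m_assoc)
    then show False using ac G by simp
  next
    assume "e \<otimes> (c \<otimes> e) = c \<otimes> (e \<otimes> c)"
    then have "a \<otimes> (c \<otimes> a) = c \<otimes> (a \<otimes> (c \<otimes> b))"
      using G by (simp add: e_def canc ba' bc' bc flip: ab)
    then have "c \<otimes> (a \<otimes> (c \<otimes> b)) = c \<otimes> (a \<otimes> (c \<otimes> \<one>))"
      using aca G by simp
    then have "b = \<one>" using G by (simp del: r_one)
    then show False using b by (simp add: involution_def)
  qed
qed

text \<open>Otherwise none of \<open>a\<close>, \<open>b\<close> and
  \<open>e = a \<otimes> b\<close> commutes with \<open>c\<close>, so each braids with
  \<open>c\<close>. The word acbca then equals cec by the relations of \<open>b\<close> and
  \<open>e\<close>, but also \<open>e\<close> by writing \<open>b\<close> as its conjugate under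
  \<open>a\<close>. Hence \<open>e\<close> and \<open>c\<close> commute after all.\<close>

lemma commuting_involutions_central:
  assumes a: "involution a" and b: "involution b" and c: "involution c"
    and "a \<noteq> b" and ab: "a \<otimes> b = b \<otimes> a"
  shows "a \<otimes> c = c \<otimes> a"
proof (rule ccontr)
  assume ac: "a \<otimes> c \<noteq> c \<otimes> a"
  have G: "a \<in> carrier G" "b \<in> carrier G" "c \<in> carrier G" using a b c by auto
  note canc = m_assoc involution_cancel[OF a] involution_cancel[OF b] involution_cancel[OF c]
    involution_square[OF a] involution_square[OF b] involution_square[OF c]
  define e where "e = a \<otimes> b"
  have e: "involution e" unfolding e_def by (rule involution_mult_commuting) fact+
  have "b \<otimes> c \<noteq> c \<otimes> b"
    using commuting_involutions_aux[OF a b c \<open>a \<noteq> b\<close> ab] ac by blast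
  then have bcb: "b \<otimes> (c \<otimes> b) = c \<otimes> (b \<otimes> c)"
    using involutions_cases[OF b c] by blast
  have aca: "a \<otimes> (c \<otimes> a) = c \<otimes> (a \<otimes> c)"
    using involutions_cases[OF a c] ac by blast
  have ec: "e \<otimes> c \<noteq> c \<otimes> e"
  proof
    assume "e \<otimes> c = c \<otimes> e"
    moreover have "a \<noteq> e" using G b by (auto simp: e_def involution_def)
    moreover have "a \<otimes> e = e \<otimes> a" using m_assoc[OF G(1,2,1)] by (simp only: e_def flip: ab)
    ultimately show False using commuting_involutions_aux[OF a e c] ac by blast
  qed
  then have "e \<otimes> (c \<otimes> e) = c \<otimes> (e \<otimes> c)"
    using involutions_cases[OF e c] by blast
  moreover have "e \<otimes> (c \<otimes> e) = a \<otimes> b \<otimes> (c \<otimes> (b \<otimes> a))"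
    by (simp only: e_def flip: ab)
  then have "e \<otimes> (c \<otimes> e) = a \<otimes> (b \<otimes> (c \<otimes> b)) \<otimes> a"
    using G by (simp add: m_assoc)
  ultimately have acbca: "a \<otimes> (c \<otimes> (b \<otimes> (c \<otimes> a))) = c \<otimes> (e \<otimes> c)"
    unfolding bcb using G by (simp add: m_assoc)
  have aba: "b = a \<otimes> (b \<otimes> a)"
    using G by (simp add: canc flip: ab)
  have "a \<otimes> (c \<otimes> (b \<otimes> (c \<otimes> a))) = a \<otimes> (c \<otimes> (a \<otimes> (b \<otimes> a) \<otimes> (c \<otimes> a)))"
    by (simp flip: aba)
  also have "\<dots> = a \<otimes> (c \<otimes> a) \<otimes> b \<otimes> (a \<otimes> (c \<otimes> a))"
    using G by (simp add: m_assoc)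
  also have "\<dots> = c \<otimes> (a \<otimes> (c \<otimes> (b \<otimes> (c \<otimes> a))) \<otimes> c)"
    unfolding aca using G by (simp add: m_assoc)
  also have "\<dots> = e"
    unfolding acbca using G e by (simp add: canc)
  finally have "c \<otimes> (c \<otimes> (e \<otimes> c)) = c \<otimes> e" using acbca by simp
  then show False using G e ec by (simp add: canc)
qed

text \<open>Otherwise the conjugates of \<open>a\<close> under the subgroup generated by \<open>a\<close>, \<open>b\<close>, \<open>c\<close> form an affine
  plane of order 3 with lines \<open>{s, t, s \<otimes> (t \<otimes> s)}\<close>, and \<open>W\<close> is the stabiliser of the line through
  \<open>a\<close> and \<open>b\<close>. On the three lines of its parallel class \<open>a\<close> and \<open>b\<close> induce the same transposition
  and \<open>c\<close> a different one, so that the permutation matrices add up to a matrix with eigenvalue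
  \<open>sqrt 3\<close>, whose eigenvector gives \<open>F\<close>.\<close>

lemma involutions_commute_or_collinear:
  assumes a: "involution a" and b: "involution b" and c: "involution c"
    and ab: "a \<otimes> b \<noteq> b \<otimes> a" and ac: "a \<otimes> c \<noteq> c \<otimes> a" and bc: "b \<otimes> c \<noteq> c \<otimes> b"
  shows "c = a \<otimes> (b \<otimes> a)"
proof (rule ccontr)
  assume cd: "c \<noteq> a \<otimes> (b \<otimes> a)"
  have G: "a \<in> carrier G" "b \<in> carrier G" "c \<in> carrier G" using a b c by auto
  note canc = m_assoc involution_cancel[OF a] involution_cancel[OF b] involution_cancel[OF c]
    involution_square[OF a] involution_square[OF b] involution_square[OF c]
  have aba: "a \<otimes> (b \<otimes> a) = b \<otimes> (a \<otimes> b)" using involutions_cases[OF a b] ab by blast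
  have aca: "a \<otimes> (c \<otimes> a) = c \<otimes> (a \<otimes> c)" using involutions_cases[OF a c] ac by blast
  have bcb: "b \<otimes> (c \<otimes> b) = c \<otimes> (b \<otimes> c)" using involutions_cases[OF b c] bc by blast
  define d where "d = a \<otimes> (b \<otimes> a)"
  have d: "involution d"
    using involution_conj[OF b G(1)] a G by (simp add: d_def involution_inv m_assoc)
  \<comment> \<open>If \<open>c\<close> commuted with the different involution \<open>d\<close>, it
    would commute with every involution, in particular with \<open>a\<close>.\<close>
  have "d \<otimes> c \<noteq> c \<otimes> d"
    using commuting_involutions_central[OF c d a] cd ac unfolding d_def by metis
  then have dcd: "d \<otimes> (c \<otimes> d) = c \<otimes> (d \<otimes> c)" using involutions_cases[OF d c] by blast
  \<comment> \<open>The product \<open>u\<close> is the translation along the line through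
    \<open>a\<close> and \<open>b\<close>, and \<open>v\<close> is its conjugate under
    \<open>c\<close>. By the relations below, \<open>v \<otimes> u\<close> commutes with
    \<open>a\<close>, \<open>b\<close> and \<open>c\<close>, so \<open>v\<close> is the inverse of
    \<open>u\<close> up to a factor acting trivially on the plane.\<close>
  define u where "u = a \<otimes> b"
  define v where "v = c \<otimes> (u \<otimes> c)"
  have uG: "u \<in> carrier G" and vG: "v \<in> carrier G" using G by (auto simp: u_def v_def)
  have u3: "u [^] (3::nat) = \<one>" unfolding u_def by (rule braid_imp_cube[OF a b aba])
  have uu: "u \<otimes> u = b \<otimes> a"
    using G aba by (simp add: u_def canc) (simp add: canc flip: aba)
  have conj: "t \<otimes> x [^] k = (t \<otimes> (x \<otimes> t)) [^] k \<otimes> t"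
    if "involution t" "x \<in> carrier G" for t x and k :: nat
  proof (induction k)
    case (Suc k)
    have "t \<otimes> x [^] Suc k = t \<otimes> x [^] k \<otimes> x" using that by (simp add: m_assoc)
    also have "\<dots> = (t \<otimes> (x \<otimes> t)) [^] Suc k \<otimes> t"
      unfolding Suc using that by (simp add: m_assoc involution_cancel involution_square)
    finally show ?case .
  qed (use that in simp)
  have v3: "v [^] (3::nat) = \<one>"
    using conj[OF c uG, of 3] u3 G uG by (simp add: v_def)
  \<comment> \<open>Written out in \<open>a\<close>, \<open>b\<close>, \<open>c\<close>, the braid
    relation of \<open>d\<close> and \<open>c\<close> becomes this commutation once the relations
    \<open>aca\<close> and \<open>bcb\<close> are applied.\<close>
  have uv: "u \<otimes> v = v \<otimes> u"
  proof -
    have "a \<otimes> (b \<otimes> (a \<otimes> (c \<otimes> (a \<otimes> (b \<otimes> a))))) = c \<otimes> (a \<otimes> (b \<otimes> (a \<otimes> c)))"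
      using dcd G by (simp add: d_def m_assoc)
    moreover have "a \<otimes> (b \<otimes> (a \<otimes> (c \<otimes> (a \<otimes> (b \<otimes> a))))) = a \<otimes> (b \<otimes> (c \<otimes> (a \<otimes> (c \<otimes> (b \<otimes> a)))))"
      using braid_tail[OF aca G(1,3), of "b \<otimes> a"] G by simp
    ultimately have "a \<otimes> (b \<otimes> (c \<otimes> (a \<otimes> (c \<otimes> (b \<otimes> a))))) = c \<otimes> (a \<otimes> (b \<otimes> (a \<otimes> c)))"
      by simp
    then have "a \<otimes> (b \<otimes> (c \<otimes> (a \<otimes> (c \<otimes> (b \<otimes> a))))) \<otimes> (a \<otimes> b)
        = c \<otimes> (a \<otimes> (b \<otimes> (a \<otimes> c))) \<otimes> (a \<otimes> b)"
      by simp
    then have abcac: "a \<otimes> (b \<otimes> (c \<otimes> (a \<otimes> c))) = c \<otimes> (a \<otimes> (b \<otimes> (a \<otimes> (c \<otimes> (a \<otimes> b)))))"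
      using G by (simp add: canc)
    have "a \<otimes> (b \<otimes> (c \<otimes> (a \<otimes> (b \<otimes> c)))) = a \<otimes> (b \<otimes> (c \<otimes> (a \<otimes> c))) \<otimes> (b \<otimes> (c \<otimes> b))"
      unfolding bcb using G by (simp add: canc)
    also have "\<dots> = c \<otimes> (a \<otimes> (b \<otimes> (a \<otimes> (c \<otimes> (a \<otimes> (c \<otimes> b))))))"
      unfolding abcac using G by (simp add: canc)
    also have "\<dots> = c \<otimes> (a \<otimes> (b \<otimes> (a \<otimes> (a \<otimes> (c \<otimes> (a \<otimes> b))))))"
      using braid_tail[OF aca G(1,3,2)] by simp
    also have "\<dots> = c \<otimes> (a \<otimes> (b \<otimes> (c \<otimes> (a \<otimes> b))))"
      using G by (simp add: canc)
    finally show ?thesis using G by (simp add: u_def v_def m_assoc)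
  qed
  \<comment> \<open>Conjugation by \<open>a\<close> sends both generators back into the abelian
    group \<open>U\<close> defined below.\<close>
  have aua: "a \<otimes> (u \<otimes> a) = u \<otimes> u"
    unfolding uu using G by (simp add: u_def canc)
  have ava: "a \<otimes> (v \<otimes> a) = v \<otimes> (u \<otimes> u)"
    unfolding uu using G braid_tail[OF aca G(1,3), of "b \<otimes> (c \<otimes> a)"] braid_tail[OF bcb G(2,3,1)]
    by (simp add: u_def v_def m_assoc)
  have vu_pow: "v [^] j \<otimes> (u [^] k \<otimes> x) = u [^] k \<otimes> (v [^] j \<otimes> x)"
    if "x \<in> carrier G" for x and j k :: nat
    using group_commutes_pow[OF group_commutes_pow[OF uv uG vG, symmetric] vG nat_pow_closed[OF uG]]
      uG vG that by (simp flip: m_assoc)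
  define U where "U = {u [^] i \<otimes> v [^] j | (i::nat) (j::nat). True}"
  have UI: "w = u [^] i \<otimes> v [^] j \<Longrightarrow> w \<in> U" for w and i j :: nat
    by (auto simp: U_def)
  have UG: "w \<in> carrier G" if "w \<in> U" for w
    using that uG vG by (auto simp: U_def)
  have Umult: "w \<otimes> w' \<in> U" if ww: "w \<in> U" "w' \<in> U" for w w'
  proof -
    obtain i j k l :: nat where w: "w = u [^] i \<otimes> v [^] j" "w' = u [^] k \<otimes> v [^] l"
      using ww by (auto simp: U_def)
    have "w \<otimes> w' = u [^] (i + k) \<otimes> v [^] (j + l)"
      using uG vG by (simp add: w m_assoc vu_pow flip: nat_pow_mult)
    then show ?thesis by (auto simp: U_def)
  qed
  have uU: "u \<in> U" and vU: "v \<in> U" and oneU: "\<one> \<in> U"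
    using UI[of u 1 0] UI[of v 0 1] UI[of \<one> 0 0] uG vG by simp_all
  have Upow: "w [^] k \<in> U" if "w \<in> U" for w and k :: nat
    by (induction k) (use that Umult oneU in auto)
  have Uu: "w \<otimes> u = u \<otimes> w" if wU: "w \<in> U" for w
  proof -
    obtain i j :: nat where w: "w = u [^] i \<otimes> v [^] j"
      using wU by (auto simp: U_def)
    have "w \<otimes> u = u [^] i \<otimes> (v [^] j \<otimes> u)"
      using uG vG by (simp add: w m_assoc)
    also have "\<dots> = u [^] i \<otimes> u \<otimes> v [^] j"
      unfolding group_commutes_pow[OF uv[symmetric] vG uG] using uG vG by (simp add: m_assoc)
    also have "u [^] i \<otimes> u = u \<otimes> u [^] i"
      using nat_pow_Suc2[OF uG] by simp
    finally show ?thesis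
      using uG vG by (simp add: w m_assoc)
  qed
  have U3: "w [^] (3::nat) = \<one>" if wU: "w \<in> U" for w
  proof -
    obtain i j :: nat where w: "w = u [^] i \<otimes> v [^] j"
      using wU by (auto simp: U_def)
    have "u [^] i \<otimes> v [^] j = v [^] j \<otimes> u [^] i"
      using group_commutes_pow[OF group_commutes_pow[OF uv uG vG, symmetric] vG nat_pow_closed[OF uG]]
      by simp
    then have "w [^] (3::nat) = (u [^] i) [^] (3::nat) \<otimes> (v [^] j) [^] (3::nat)"
      unfolding w using uG vG by (intro pow_mult_distrib) auto
    also have "\<dots> = (u [^] (3::nat)) [^] i \<otimes> (v [^] (3::nat)) [^] j"
      using uG vG by (simp add: nat_pow_pow mult.commute)
    also have "\<dots> = \<one>" by (simp add: u3 v3)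
    finally show ?thesis .
  qed
  have aU: "\<exists>w'\<in>U. a \<otimes> w = w' \<otimes> a" if wU: "w \<in> U" for w
  proof -
    obtain i j :: nat where w: "w = u [^] i \<otimes> v [^] j"
      using wU by (auto simp: U_def)
    let ?w = "(u \<otimes> u) [^] i \<otimes> (v \<otimes> (u \<otimes> u)) [^] j"
    have "a \<otimes> w = a \<otimes> u [^] i \<otimes> v [^] j" using G uG vG by (simp add: w m_assoc)
    also have "\<dots> = (u \<otimes> u) [^] i \<otimes> (a \<otimes> v [^] j)"
      unfolding conj[OF a uG] aua using G uG vG by (simp add: m_assoc)
    also have "\<dots> = ?w \<otimes> a"
      unfolding conj[OF a vG] ava using G uG vG by (simp add: m_assoc)
    finally have "a \<otimes> w = ?w \<otimes> a" .
    moreover have "?w \<in> U" by (intro Umult Upow uU vU)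
    ultimately show ?thesis by blast
  qed
  define W where "W = U \<union> (\<lambda>w. w \<otimes> a) ` U"
  have UW: "s \<otimes> h \<in> W" if "s \<in> U" "h \<in> W" for s h
  proof -
    have "s \<otimes> (w \<otimes> a) = s \<otimes> w \<otimes> a" if "w \<in> U" for w
      using UG \<open>s \<in> U\<close> that G by (simp add: m_assoc)
    then show ?thesis using that Umult by (auto simp: W_def)
  qed
  have aW: "a \<otimes> h \<in> W" if "h \<in> W" for h
  proof -
    have "a \<otimes> (w \<otimes> a) \<in> U" if w: "w \<in> U" for w
    proof -
      obtain w' where "w' \<in> U" "a \<otimes> w = w' \<otimes> a" using aU[OF w] by blast
      moreover have "a \<otimes> (w \<otimes> a) = a \<otimes> w \<otimes> a" using G UG[OF w] by (simp add: m_assoc)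
      ultimately show ?thesis using G UG by (simp add: canc)
    qed
    then show ?thesis using that aU by (auto simp: W_def)
  qed
  \<comment> \<open>The equivalences from here to \<open>cac_iff\<close> describe how
    \<open>a\<close>, \<open>b\<close> and \<open>c\<close> permute the left cosets of
    \<open>W\<close> with representatives \<open>\<one>\<close>, \<open>c\<close> and
    \<open>a \<otimes> c\<close>.\<close>
  have a_iff: "a \<otimes> h \<in> W \<longleftrightarrow> h \<in> W" if "h \<in> carrier G" for h
    using aW[of h] aW[of "a \<otimes> h"] that G a by (auto simp: involution_cancel)
  have U_iff: "s \<otimes> h \<in> W \<longleftrightarrow> h \<in> W" if "s \<in> U" "h \<in> carrier G" for s h
  proof -
    \<comment> \<open>Two further factors \<open>s\<close> lead from \<open>s \<otimes> h\<close>
      back to \<open>h\<close>, which reverses \<open>UW\<close>.\<close>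
    have "s \<otimes> (s \<otimes> (s \<otimes> h)) = s [^] (3::nat) \<otimes> h"
      using that UG by (simp add: numeral_3_eq_3 m_assoc)
    also have "\<dots> = h" using that U3 by simp
    finally show ?thesis using UW that(1) by metis
  qed
  have b_iff: "b \<otimes> h \<in> W \<longleftrightarrow> h \<in> W" if h: "h \<in> carrier G" for h
  proof -
    have "b \<otimes> h = a \<otimes> (u \<otimes> h)" using G h by (simp add: u_def canc)
    then show ?thesis using a_iff U_iff[OF uU h] uG h by simp
  qed
  have cab_iff: "c \<otimes> (a \<otimes> (b \<otimes> h)) \<in> W \<longleftrightarrow> c \<otimes> h \<in> W" if h: "h \<in> carrier G" for h
  proof -
    have "c \<otimes> (a \<otimes> (b \<otimes> h)) = v \<otimes> (c \<otimes> h)" using G h by (simp add: u_def v_def canc)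
    then show ?thesis using U_iff[OF vU] G h by simp
  qed
  have cb_iff: "c \<otimes> (b \<otimes> h) \<in> W \<longleftrightarrow> c \<otimes> (a \<otimes> h) \<in> W" if h: "h \<in> carrier G" for h
    using cab_iff[of "b \<otimes> h"] G h b by (simp add: involution_cancel)
  have cac_iff: "c \<otimes> (a \<otimes> (c \<otimes> h)) \<in> W \<longleftrightarrow> c \<otimes> (a \<otimes> h) \<in> W" if h: "h \<in> carrier G" for h
    using braid_tail[OF aca G(1,3) h] a_iff[of "c \<otimes> (a \<otimes> h)"] G h by simp
  have "c \<notin> W"
  proof
    assume "c \<in> W"
    then consider "c \<in> U" | w where "w \<in> U" "c = w \<otimes> a" by (auto simp: W_def)
    then show False
    proof cases
      case 1
      then have "c \<otimes> (c \<otimes> c) = \<one>" using U3[OF 1] G by (simp add: numeral_3_eq_3 m_assoc)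
      then show False using c G by (simp add: involution_def)
    next
      case 2
      have wG: "w \<in> carrier G" using UG 2 by blast
      \<comment> \<open>As \<open>w\<close> commutes with \<open>u\<close>, so does
        \<open>c \<otimes> a\<close>, which forces \<open>v = u \<otimes> u\<close>. Then
        \<open>U\<close> consists of the three powers of \<open>u\<close>, and \<open>c\<close>
        would lie on the line of \<open>a\<close> and \<open>b\<close>.\<close>
      have "w = c \<otimes> a" using 2 wG G by (simp add: canc)
      then have "c \<otimes> a \<otimes> (a \<otimes> b) = a \<otimes> b \<otimes> (c \<otimes> a)"
        using Uu[OF 2(1)] by (simp add: u_def)
      then have "c \<otimes> b = a \<otimes> (b \<otimes> (c \<otimes> a))" using G by (simp add: canc)
      then have "c \<otimes> (c \<otimes> b) \<otimes> a = c \<otimes> (a \<otimes> (b \<otimes> (c \<otimes> a))) \<otimes> a" by simp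
      then have vuu: "v = u \<otimes> u" unfolding uu using G by (simp add: u_def v_def canc)
      obtain i j :: nat where w: "w = u [^] i \<otimes> v [^] j"
        using 2(1) by (auto simp: U_def)
      have "v = u [^] (2::nat)" using uG by (simp add: vuu numeral_2_eq_2)
      then have "w = u [^] (i + 2 * j)"
        using uG by (simp add: w nat_pow_pow nat_pow_mult)
      also have "\<dots> = u [^] ((i + 2 * j) mod 3)"
      proof -
        have "u [^] (i + 2 * j) = u [^] (3 * ((i + 2 * j) div 3) + (i + 2 * j) mod 3)" by simp
        also have "\<dots> = (u [^] (3::nat)) [^] ((i + 2 * j) div 3) \<otimes> u [^] ((i + 2 * j) mod 3)"
          using uG by (simp only: nat_pow_pow nat_pow_mult)
        finally show ?thesis using uG u3 by simp
      qed
      finally have "w = u [^] ((i + 2 * j) mod 3)" .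
      moreover have "(i + 2 * j) mod 3 \<in> {0, 1, 2}" by auto
      ultimately have "w = \<one> \<or> w = u \<or> w = u \<otimes> u" using uG by (auto simp: numeral_2_eq_2)
      then have "c = a \<or> c = a \<otimes> (b \<otimes> a) \<or> c = b"
        unfolding 2(2) uu using G by (auto simp: u_def canc)
      then show False using cd ac bc by blast
    qed
  qed
  define r where "r = complex_of_real (sqrt 3)"
  have rr: "r * r = 3" by (simp add: r_def flip: of_real_mult)
  define X :: "'a \<Rightarrow> complex" where "X h = (if h \<in> W then 1 else 0)" for h
  \<comment> \<open>The three terms are supported on the three cosets. There \<open>a\<close> and
    \<open>b\<close> fix the first and swap the other two, while \<open>c\<close> swaps the first
    two; the sum has rows (2, 1, 0), (1, 0, 2), (0, 2, 1). The coefficients 1, r - 2, 1 - r form an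
    eigenvector for \<open>r\<close>.\<close>
  define F where "F h = X h + (r - 2) * X (c \<otimes> h) + (1 - r) * X (c \<otimes> (a \<otimes> h))" for h
  have r_not_int: "r \<notin> \<int>"
  proof
    assume "r \<in> \<int>"
    then obtain k :: int where "sqrt 3 = of_int k"
      unfolding r_def of_real_in_Ints_iff by (auto elim: Ints_cases)
    moreover have "1 < sqrt 3" "sqrt 3 < 2" by (simp_all add: real_less_lsqrt)
    ultimately show False by simp
  qed
  have "r \<in> \<int>"
  proof (rule integral_setD[where f = F and g = \<one>])
    show "integral_set {a, b, c}"
      using ab ac bc by (intro integral_set_involutions a b c) auto
    have "\<one> \<in> W" using oneU by (simp add: W_def)
    \<comment> \<open>The membership of \<open>c \<otimes> a\<close> in \<open>W\<close> is left
      undecided: \<open>F \<one>\<close> is 1 or 2 - r.\<close>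
    moreover have "r \<noteq> 2" using r_not_int by auto
    ultimately show "F \<one> \<noteq> 0"
      using \<open>c \<notin> W\<close> G by (auto simp: F_def X_def)
    fix h assume h: "h \<in> carrier G"
    have Fa: "F (a \<otimes> h) = X h + (r - 2) * X (c \<otimes> (a \<otimes> h)) + (1 - r) * X (c \<otimes> h)"
      using h G by (simp add: F_def X_def a_iff canc)
    have Fb: "F (b \<otimes> h) = X h + (r - 2) * X (c \<otimes> (a \<otimes> h)) + (1 - r) * X (c \<otimes> h)"
      using h G by (simp add: F_def X_def b_iff cb_iff cab_iff)
    have Fc: "F (c \<otimes> h) = X (c \<otimes> h) + (r - 2) * X h + (1 - r) * X (c \<otimes> (a \<otimes> h))"
      using h G by (simp add: F_def X_def cac_iff canc)
    have Fr: "r * F h = r * X h + (3 - 2 * r) * X (c \<otimes> h) + (r - 3) * X (c \<otimes> (a \<otimes> h))"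
      using rr by (simp add: F_def algebra_simps flip: mult.assoc)
    have "a \<noteq> b" "a \<noteq> c" "b \<noteq> c" using ab ac bc by auto
    then have "(\<Sum>s\<in>{a, b, c}. F (s \<otimes> h)) = F (a \<otimes> h) + (F (b \<otimes> h) + F (c \<otimes> h))"
      by simp
    also have "\<dots> = r * F h"
      unfolding Fa Fb Fc Fr by (simp add: algebra_simps)
    finally show "(\<Sum>s\<in>{a, b, c}. F (s \<otimes> h)) = r * F h" .
  qed simp
  with r_not_int show False ..
qed

end

section \<open>Elements of odd order\<close>

context finite_group
begin

lemma odd_ord_dvd_six:
  assumes "x \<in> carrier G" "odd (ord x)" "ord x dvd 6"
  shows "x [^] (3::nat) = \<one>"
proof -
  have "coprime (ord x) 2" using assms(2) by simp
  then have "ord x dvd 3"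
    using assms(3) coprime_dvd_mult_right_iff[of "ord x" 2 3] by simp
  then show ?thesis using assms(1) pow_eq_id by blast
qed

lemma odd_ord_ne_inv:
  assumes "x \<in> carrier G" "odd (ord x)" "x \<noteq> \<one>"
  shows "x \<noteq> inv x"
proof
  assume "x = inv x"
  then have "x \<otimes> x = \<one>" using assms(1) r_inv by metis
  then have "x [^] (2::nat) = \<one>" using assms(1) by (simp add: numeral_2_eq_2)
  then have "ord x dvd 2" using assms(1) pow_eq_id by blast
  then have "ord x \<le> 2" by (simp add: dvd_imp_le)
  then have "ord x = 1" using assms(2) by presburger
  then show False using assms ord_eq_1 by blast
qed

text \<open>The operator T = x + x^2 satisfies T^2 = T + 2 because x^3 = 1, so its eigenvalues are
  roots of (k - 2) (k + 1).\<close>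

lemma cube_eq_one_eigenvalue:
  fixes f :: "'a \<Rightarrow> complex"
  assumes x: "x \<in> carrier G" "x [^] (3::nat) = \<one>" and g: "g \<in> carrier G" "f g \<noteq> 0"
    and f: "\<And>h. h \<in> carrier G \<Longrightarrow> f (x \<otimes> h) + f (inv x \<otimes> h) = k * f h"
  shows "k = 2 \<or> k = - 1"
proof -
  have xxx: "x \<otimes> (x \<otimes> x) = \<one>" using x by (simp add: numeral_3_eq_3 m_assoc)
  have xx: "inv x = x \<otimes> x" using inv_equality[of "x \<otimes> x" x] xxx x(1) by (simp add: m_assoc)
  have xxxg: "x \<otimes> (x \<otimes> (x \<otimes> h)) = h" if "h \<in> carrier G" for h
    using xxx x(1) that by (metis m_assoc m_closed l_one)
  have f': "f (x \<otimes> h) + f (x \<otimes> (x \<otimes> h)) = k * f h" if "h \<in> carrier G" for h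
    using f[OF that] x(1) that by (simp add: xx m_assoc)
  have "k * f (x \<otimes> g) = f (x \<otimes> (x \<otimes> g)) + f g"
    using f'[of "x \<otimes> g"] x(1) g(1) by (simp add: xxxg)
  moreover have "k * f (x \<otimes> (x \<otimes> g)) = f g + f (x \<otimes> g)"
    using f'[of "x \<otimes> (x \<otimes> g)"] x(1) g(1) by (simp add: xxxg)
  ultimately have "k * (f (x \<otimes> g) + f (x \<otimes> (x \<otimes> g)))
      = (f (x \<otimes> g) + f (x \<otimes> (x \<otimes> g))) + 2 * f g"
    by (simp add: algebra_simps)
  then have "((k - 2) * (k + 1)) * f g = 0"
    unfolding f'[OF g(1)] by (simp add: algebra_simps)
  then have "(k - 2) * (k + 1) = 0" using g(2) by simp
  then show ?thesis by (auto simp: eq_neg_iff_add_eq_0)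
qed

lemma integral_set_empty: "integral_set {}"
proof (rule integral_setI)
  fix f :: "'a \<Rightarrow> complex" and k g
  assume "g \<in> carrier G" "f g \<noteq> 0"
    and "\<And>h. h \<in> carrier G \<Longrightarrow> (\<Sum>s\<in>{}. f (s \<otimes> h)) = k * f h"
  then have "k * f g = 0" by (metis sum.empty)
  with \<open>f g \<noteq> 0\<close> show "k \<in> \<int>" by simp
qed

lemma integral_set_involution:
  assumes t: "involution t"
  shows "integral_set {t}"
proof (rule integral_setI)
  fix f :: "'a \<Rightarrow> complex" and k g
  assume g: "g \<in> carrier G" "f g \<noteq> 0"
    and f: "\<And>h. h \<in> carrier G \<Longrightarrow> (\<Sum>s\<in>{t}. f (s \<otimes> h)) = k * f h"
  have "f g = k * (k * f g)"
    using f[of g] f[of "t \<otimes> g"] t g(1) by (simp add: involution_cancel)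
  then have "(k - 1) * (k + 1) = 0" using g(2) by (simp add: algebra_simps)
  then have "k = 1 \<or> k = - 1" by (auto simp: eq_neg_iff_add_eq_0)
  then show "k \<in> \<int>" by auto
qed

lemma integral_set_cube_eq_one:
  assumes "x \<in> carrier G" "x [^] (3::nat) = \<one>" "x \<noteq> inv x"
  shows "integral_set {x, inv x}"
proof (rule integral_setI)
  fix f :: "'a \<Rightarrow> complex" and k g
  assume "g \<in> carrier G" "f g \<noteq> 0"
    and "\<And>h. h \<in> carrier G \<Longrightarrow> (\<Sum>s\<in>{x, inv x}. f (s \<otimes> h)) = k * f h"
  then have "k = 2 \<or> k = - 1"
    using cube_eq_one_eigenvalue[of x g f k] assms by simp
  then show "k \<in> \<int>" by auto
qed

text \<open>Squaring the operator shows that \<open>a \<otimes> b\<close> plus its inverse has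
  eigenvalue k^2 - 2. For commuting \<open>a\<close> and \<open>b\<close> this is twice an
  involution, giving 2 or -2; in the braid case \<open>a \<otimes> b\<close> has trivial cube,
  giving 2 or -1.\<close>

lemma integral_set_two_involutions:
  assumes a: "involution a" and b: "involution b" and ne: "a \<noteq> b"
    and ab: "a \<otimes> b = b \<otimes> a \<or> a \<otimes> (b \<otimes> a) = b \<otimes> (a \<otimes> b)"
  shows "integral_set {a, b}"
proof (rule integral_setI)
  fix f :: "'a \<Rightarrow> complex" and k g
  assume g: "g \<in> carrier G" "f g \<noteq> 0"
    and f: "\<And>h. h \<in> carrier G \<Longrightarrow> (\<Sum>s\<in>{a, b}. f (s \<otimes> h)) = k * f h"
  have G: "a \<in> carrier G" "b \<in> carrier G" using a b by auto
  have inv: "inv (a \<otimes> b) = b \<otimes> a" using a b by (simp add: inv_mult_group involution_inv)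
  have f': "f (a \<otimes> h) + f (b \<otimes> h) = k * f h" if "h \<in> carrier G" for h
    using f[OF that] ne by simp
  have ff: "f (a \<otimes> b \<otimes> h) + f (b \<otimes> a \<otimes> h) = (k\<^sup>2 - 2) * f h" if h: "h \<in> carrier G" for h
  proof -
    have "k * f (a \<otimes> h) = f h + f (b \<otimes> (a \<otimes> h))"
      using f'[of "a \<otimes> h"] h a G by (simp add: involution_cancel)
    moreover have "k * f (b \<otimes> h) = f (a \<otimes> (b \<otimes> h)) + f h"
      using f'[of "b \<otimes> h"] h b G by (simp add: involution_cancel)
    ultimately have "k * (f (a \<otimes> h) + f (b \<otimes> h)) = f (a \<otimes> (b \<otimes> h)) + f (b \<otimes> (a \<otimes> h)) + 2 * f h"
      by (simp add: algebra_simps)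
    then show ?thesis
      unfolding f'[OF h] using G h by (simp add: m_assoc algebra_simps power2_eq_square)
  qed
  have "k\<^sup>2 \<in> {0, 1, 4}"
  proof (cases "a \<otimes> b = b \<otimes> a")
    case True
    have e: "involution (a \<otimes> b)" by (rule involution_mult_commuting) fact+
    have fe: "2 * f (a \<otimes> b \<otimes> h) = (k\<^sup>2 - 2) * f h" if "h \<in> carrier G" for h
      using ff[OF that] unfolding True[symmetric] by simp
    have "2 * f g = (k\<^sup>2 - 2) * f (a \<otimes> b \<otimes> g)"
      using fe[of "a \<otimes> b \<otimes> g"] involution_cancel[OF e g(1)] g(1) G by simp
    then have "2 * (2 * f g) = (k\<^sup>2 - 2) * (2 * f (a \<otimes> b \<otimes> g))" by simp
    also have "\<dots> = (k\<^sup>2 - 2) * ((k\<^sup>2 - 2) * f g)" unfolding fe[OF g(1)] ..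
    finally have "2 * (2 * f g) = (k\<^sup>2 - 2) * ((k\<^sup>2 - 2) * f g)" .
    then have "(k\<^sup>2 * (k\<^sup>2 - 4)) * f g = 0" by (auto simp: algebra_simps)
    then show ?thesis using g(2) by auto
  next
    case False
    then have "(a \<otimes> b) [^] (3::nat) = \<one>" using ab braid_imp_cube[OF a b] by blast
    then have "k\<^sup>2 - 2 = 2 \<or> k\<^sup>2 - 2 = - 1"
      using cube_eq_one_eigenvalue[of "a \<otimes> b" g f "k\<^sup>2 - 2"] g ff G unfolding inv by simp
    then show ?thesis by (auto simp: algebra_simps)
  qed
  then have "k\<^sup>2 = 0\<^sup>2 \<or> k\<^sup>2 = 1\<^sup>2 \<or> k\<^sup>2 = 2\<^sup>2" by simp
  then have "k = 0 \<or> k = 1 \<or> k = - 1 \<or> k = 2 \<or> k = - 2" unfolding power2_eq_iff by auto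
  then show "k \<in> \<int>" by auto
qed

end

section \<open>The normal subgroup generated by the involutions\<close>

context cubic_integral_group
begin

lemma integral_set_inverse_pair_involution:
  assumes t: "involution t" and x: "x \<in> carrier G" "x \<noteq> inv x"
  shows "integral_set {t, x, inv x}" and "t \<noteq> x" "t \<noteq> inv x"
proof -
  show ne: "t \<noteq> x" "t \<noteq> inv x" using involution_inv[OF t] x by auto
  have "x \<noteq> \<one>" "inv x \<noteq> \<one>" "t \<noteq> \<one>"
    using x t by (auto simp: involution_def)
  then have "\<one> \<notin> {t, x, inv x}" by (metis empty_iff insert_iff)
  moreover have "m_inv G ` {t, x, inv x} = {t, x, inv x}"
    using x by (simp add: involution_inv[OF t] insert_commute)
  ultimately have "connection_set G {t, x, inv x}"
    unfolding connection_set_def using t x(1) by (simp del: insert_iff)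
  moreover have "card {t, x, inv x} = 3" using ne x(2) by simp
  ultimately show "integral_set {t, x, inv x}" by (rule cubic_integral)
qed

lemma integral_inverse_pair_commuting:
  assumes t: "involution t" and x: "x \<in> carrier G" "x \<noteq> inv x" and tx: "t \<otimes> x = x \<otimes> t"
  shows "integral_set {x, inv x}"
proof (rule integral_set_remove_commuting_involution)
  note I = integral_set_inverse_pair_involution[OF t x]
  show "integral_set {t, x, inv x}" by (rule I)
  show "t \<notin> {x, inv x}" using I by simp
  have "inv x \<otimes> t = inv (t \<otimes> x)" using t x by (simp add: inv_mult_group involution_inv)
  also have "\<dots> = t \<otimes> inv x" unfolding tx using t x by (simp add: inv_mult_group involution_inv)
  finally show "s \<otimes> t = t \<otimes> s" if "s \<in> {x, inv x}" for s using that tx by auto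
  show "{x, inv x} \<subseteq> carrier G" "t \<in> carrier G" "t \<otimes> t = \<one>"
    using t x(1) by (simp_all add: involution_square)
qed

text \<open>Once an involution exists, this is the whole subgroup generated by the involutions; the
  identity occurs as the product of an involution with itself.\<close>

definition involution_products :: "'a set" where
  "involution_products = {t. involution t} \<union> {s \<otimes> t | s t. involution s \<and> involution t}"

text \<open>Commuting neighbours merge into an involution or cancel. If \<open>d = f\<close>, the
  product is a conjugate of \<open>e\<close>; if \<open>d\<close> and \<open>f\<close> commute and
  differ, then \<open>d\<close> also commutes with \<open>e\<close>. If no two commute,
  \<open>f\<close> is the third point on the line of \<open>d\<close> and \<open>e\<close>, and the
  product is \<open>e\<close>.\<close>

lemma involution_triple_product:
  assumes d: "involution d" and e: "involution e" and f: "involution f"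
  shows "d \<otimes> (e \<otimes> f) \<in> involution_products"
proof -
  have G: "d \<in> carrier G" "e \<in> carrier G" "f \<in> carrier G" using d e f by auto
  have de: ?thesis if "d \<otimes> e = e \<otimes> d"
  proof (cases "d = e")
    case True
    then show ?thesis using f e by (simp add: involution_cancel involution_products_def)
  next
    case False
    then have "involution (d \<otimes> e)" using involution_mult_commuting[OF d e] that by blast
    then show ?thesis
      using f G by (auto simp: involution_products_def simp flip: m_assoc)
  qed
  have ef: ?thesis if "e \<otimes> f = f \<otimes> e"
  proof (cases "e = f")
    case True
    then show ?thesis using d f by (simp add: involution_square involution_products_def)
  next
    case False
    then have "involution (e \<otimes> f)" using involution_mult_commuting[OF e f] that by blast
    then show ?thesis using d by (auto simp: involution_products_def)
  qed
  consider "d \<otimes> e = e \<otimes> d" | "e \<otimes> f = f \<otimes> e" | "d = f"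
    | "d \<otimes> e \<noteq> e \<otimes> d" "e \<otimes> f \<noteq> f \<otimes> e" "d \<otimes> f \<noteq> f \<otimes> d"
    using commuting_involutions_central[OF d f e] by blast
  then show ?thesis
  proof cases
    case 3
    have "involution (d \<otimes> e \<otimes> inv d)" by (rule involution_conj[OF e G(1)])
    then show ?thesis
      using 3 d G by (simp add: involution_inv m_assoc involution_products_def)
  next
    case 4
    then have f_eq: "f = d \<otimes> (e \<otimes> d)"
      using involutions_commute_or_collinear[OF d e f] by blast
    have "d \<otimes> (e \<otimes> d) = e \<otimes> (d \<otimes> e)" using involutions_cases[OF d e] 4 by blast
    then have "e \<otimes> (d \<otimes> (e \<otimes> d)) = d \<otimes> e"
      using e G by (simp add: involution_cancel)
    then have "d \<otimes> (e \<otimes> f) = e" unfolding f_eq using d G by (simp add: involution_cancel)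
    then show ?thesis using e by (simp add: involution_products_def)
  qed (fact de ef)+
qed

text \<open>Products are formed by multiplying with one involution at a time, so closure reduces to
  triple products. Conjugation permutes the involutions.\<close>

lemma involution_products_normal:
  assumes t: "involution t"
  shows "involution_products \<lhd> G"
proof (rule normal_invI)
  let ?M = involution_products
  have carr: "?M \<subseteq> carrier G" by (auto simp: involution_products_def)
  have DM: "d \<otimes> m \<in> ?M" if "involution d" "m \<in> ?M" for d m
  proof -
    from that(2) consider "involution m" | s t where "m = s \<otimes> t" "involution s" "involution t"
      by (auto simp: involution_products_def)
    then show ?thesis
    proof cases
      case 1
      then show ?thesis using that(1) by (auto simp: involution_products_def)
    next
      case 2
      then show ?thesis using involution_triple_product that(1) by blast
    qed
  qed
  show "subgroup ?M G"
  proof (rule subgroupI)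
    show "?M \<noteq> {}" using t by (auto simp: involution_products_def)
    show "inv m \<in> ?M" if "m \<in> ?M" for m
    proof -
      from that consider "involution m" | d e where "m = d \<otimes> e" "involution d" "involution e"
        by (auto simp: involution_products_def)
      then show ?thesis
      proof cases
        case 1
        then show ?thesis using that by (simp add: involution_inv)
      next
        case 2
        then have "inv m = e \<otimes> d" by (simp add: inv_mult_group involution_inv)
        then show ?thesis using 2 unfolding involution_products_def by blast
      qed
    qed
    show "m \<otimes> n \<in> ?M" if m: "m \<in> ?M" and n: "n \<in> ?M" for m n
    proof -
      from m consider "involution m" | d e where "m = d \<otimes> e" "involution d" "involution e"
        by (auto simp: involution_products_def)
      then show ?thesis
      proof cases
        case 1
        then show ?thesis using DM n by blast
      next
        case 2
        then have "m \<otimes> n = d \<otimes> (e \<otimes> n)" using n carr by (simp add: m_assoc subset_iff)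
        then show ?thesis using DM 2 n by simp
      qed
    qed
  qed (rule carr)
  fix x m assume x: "x \<in> carrier G" and m: "m \<in> ?M"
  have conj: "x \<otimes> (d \<otimes> e) \<otimes> inv x = (x \<otimes> d \<otimes> inv x) \<otimes> (x \<otimes> e \<otimes> inv x)"
    if "involution d" "involution e" for d e
  proof -
    have "inv x \<otimes> (x \<otimes> (e \<otimes> inv x)) = e \<otimes> inv x"
      using x that by (simp flip: m_assoc)
    then show ?thesis using that x by (simp add: m_assoc)
  qed
  from m consider "involution m" | d e where "m = d \<otimes> e" "involution d" "involution e"
    by (auto simp: involution_products_def)
  then show "x \<otimes> m \<otimes> inv x \<in> ?M"
  proof cases
    case 1
    then show ?thesis using involution_conj[OF 1 x] by (simp add: involution_products_def)
  next
    case 2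
    then show ?thesis
      unfolding 2(1) conj[OF 2(2,3)] involution_products_def
      using involution_conj[OF _ x] by blast
  qed
qed

section \<open>Cubes of elements of odd order\<close>

text \<open>Here \<open>d\<close>, \<open>e\<close> and \<open>d \<otimes> (e \<otimes> d)\<close> are the only involutions, and conjugation by \<open>x\<close> permutes
  them without fixed points, that is, cyclically.\<close>

lemma cube_commutes_with_involution:
  assumes x: "x \<in> carrier G" and d: "involution d" and e: "involution e"
    and de: "d \<otimes> e \<noteq> e \<otimes> d" and nofix: "\<And>t. involution t \<Longrightarrow> t \<otimes> x \<noteq> x \<otimes> t"
  shows "x [^] (3::nat) \<otimes> d = d \<otimes> x [^] (3::nat)"
proof -
  have G: "d \<in> carrier G" "e \<in> carrier G" using d e by auto
  define f where "f = d \<otimes> (e \<otimes> d)"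
  have f: "involution f"
    using involution_conj[OF e G(1)] d G by (simp add: f_def involution_inv m_assoc)
  have only: "t = d \<or> t = e \<or> t = f" if t: "involution t" for t
  proof (rule ccontr)
    assume *: "\<not> ?thesis"
    \<comment> \<open>A further involution commuting with \<open>d\<close> or with \<open>e\<close>
      would make that one commute with all involutions, against \<open>de\<close>.\<close>
    have "d \<otimes> t \<noteq> t \<otimes> d" using commuting_involutions_central[OF d t e] * de by blast
    moreover have "e \<otimes> t \<noteq> t \<otimes> e" using commuting_involutions_central[OF e t d] * de by metis
    ultimately show False
      using involutions_commute_or_collinear[OF d e t de] * by (simp add: f_def)
  qed
  have "d \<noteq> f" "e \<noteq> f"
  proof -
    show "e \<noteq> f"
    proof
      assume "e = f"
      then have "d \<otimes> e = d \<otimes> (d \<otimes> (e \<otimes> d))" by (simp add: f_def)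
      then show False using de d G by (simp add: involution_cancel)
    qed
    show "d \<noteq> f"
    proof
      assume "d = f"
      then have "e \<otimes> d = \<one>" using G by (simp add: f_def)
      then have "e = d" using inv_equality[of e d] involution_inv[OF d] G by simp
      then show False using de by simp
    qed
  qed
  moreover have "d \<noteq> e" using de by auto
  moreover define p where "p t = x \<otimes> t \<otimes> inv x" for t
  have "involution t \<Longrightarrow> p t \<in> {d, e, f}" for t
    using only[of "p t"] involution_conj[of t x] x unfolding p_def by blast
  then have "p d \<in> {d, e, f}" "p e \<in> {d, e, f}" "p f \<in> {d, e, f}" using d e f by blast+
  moreover have "p t \<noteq> t" if "involution t" for t
  proof
    assume "p t = t"
    then have "x \<otimes> t \<otimes> inv x \<otimes> x = t \<otimes> x" by (simp add: p_def)
    then show False using nofix[OF that] that x by (simp add: m_assoc)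
  qed
  then have "p d \<noteq> d" "p e \<noteq> e" "p f \<noteq> f" using d e f by blast+
  moreover have "s = t" if "p s = p t" "involution s" "involution t" for s t
    using that x by (simp add: p_def)
  then have "p d \<noteq> p e" "p d \<noteq> p f" "p e \<noteq> p f"
    using d e f \<open>d \<noteq> e\<close> \<open>d \<noteq> f\<close> \<open>e \<noteq> f\<close> by blast+
  ultimately have "p (p (p d)) = d" by auto
  moreover have "p (p (p d)) = x [^] (3::nat) \<otimes> d \<otimes> inv (x [^] (3::nat))"
    using x G by (simp add: p_def numeral_3_eq_3 inv_mult_group m_assoc)
  ultimately have "x [^] (3::nat) \<otimes> d \<otimes> inv (x [^] (3::nat)) \<otimes> x [^] (3::nat) = d \<otimes> x [^] (3::nat)"
    by simp
  then show ?thesis using x G by (simp add: m_assoc)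
qed

lemma odd_order_cube_eq_one:
  assumes t: "involution t" and x: "x \<in> carrier G" "odd (ord x)"
  shows "x [^] (3::nat) = \<one>"
proof (cases "x = \<one> \<or> (\<exists>s. involution s \<and> s \<otimes> x = x \<otimes> s)")
  case True
  then show ?thesis
  proof
    assume "\<exists>s. involution s \<and> s \<otimes> x = x \<otimes> s"
    then obtain s where s: "involution s" "s \<otimes> x = x \<otimes> s" by blast
    show ?thesis
    proof (cases "x = \<one>")
      case False
      then have ne: "x \<noteq> inv x" using odd_ord_ne_inv x by blast
      have "ord x \<in> {1, 2, 3, 4, 6}"
        by (rule integral_inverse_pair_imp[OF integral_inverse_pair_commuting[OF s(1) x(1) ne s(2)] x(1) ne])
      then have "ord x = 1 \<or> ord x = 3" using x(2) by auto
      then have "ord x dvd 3" by auto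
      then show ?thesis using pow_eq_id x(1) by blast
    qed simp
  qed simp
next
  case False
  then have ne: "x \<noteq> inv x" using odd_ord_ne_inv x by blast
  have nofix: "\<And>s. involution s \<Longrightarrow> s \<otimes> x \<noteq> x \<otimes> s" using False by blast
  note I = integral_set_inverse_pair_involution[OF t x(1) ne]
  have sq: ?thesis if "involution (x [^] (3::nat))"
  proof -
    have "x [^] (6::nat) = \<one>"
      using involution_square[OF that] x(1) by (simp add: nat_pow_mult)
    then have "ord x dvd 6" using pow_eq_id x(1) by blast
    then show ?thesis using odd_ord_dvd_six x by blast
  qed
  have "integral_set {x, inv x, t}" using I(1) by (simp add: insert_commute)
  then have "x [^] (3::nat) \<in> involution_products"
    using t I ne x by (intro odd_order_cube_mem[of _ x t] involution_products_normal[OF t])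
      (auto simp: involution_products_def)
  then consider "involution (x [^] (3::nat))"
    | d e where "x [^] (3::nat) = d \<otimes> e" "involution d" "involution e"
    by (auto simp: involution_products_def)
  then show ?thesis
  proof cases
    case 2
    have G: "d \<in> carrier G" "e \<in> carrier G" using 2 by auto
    consider "d = e" | "d \<noteq> e" "d \<otimes> e = e \<otimes> d" | "d \<otimes> e \<noteq> e \<otimes> d" by blast
    then show ?thesis
    proof cases
      case 1
      then show ?thesis using 2 by (simp add: involution_square)
    next
      case c: 2
      have "involution (x [^] (3::nat))"
        unfolding 2(1) by (rule involution_mult_commuting[OF 2(2,3) c])
      then show ?thesis by (rule sq)
    next
      case 3
      have "d \<otimes> e \<otimes> d = d \<otimes> (d \<otimes> e)"
        using cube_commutes_with_involution[OF x(1) 2(2,3) 3 nofix] unfolding 2(1) .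
      then have "e \<otimes> d = d \<otimes> e" using G by (simp add: m_assoc)
      then show ?thesis using 3 by simp
    qed
  qed (rule sq)
qed

lemma integral_set_inverse_pair:
  assumes t: "involution t" and x: "x \<in> carrier G" "x \<noteq> inv x"
  shows "integral_set {x, inv x}"
proof (cases "odd (ord x)")
  case True
  then show ?thesis
    using integral_set_cube_eq_one odd_order_cube_eq_one[OF t] x by blast
next
  case False
  define k where "k = ord x div 2"
  have k: "ord x = k + k" "k > 0" using False ord_pos[OF x(1)] unfolding k_def by presburger+
  have "x [^] k \<noteq> \<one>"
  proof
    assume "x [^] k = \<one>"
    then have "ord x dvd k" using x(1) pow_eq_id by blast
    then have "ord x \<le> k" using k(2) by (rule dvd_imp_le)
    then show False using k by simp
  qed
  moreover have "x [^] k \<otimes> x [^] k = \<one>"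
    using x(1) k(1) pow_ord_eq_1[OF x(1)] by (simp add: nat_pow_mult)
  ultimately have "involution (x [^] k)" using x(1) by (simp add: involution_def)
  moreover have "x [^] k \<otimes> x = x \<otimes> x [^] k" using nat_pow_Suc2[OF x(1), of k] by simp
  ultimately show ?thesis by (rule integral_inverse_pair_commuting[OF _ x])
qed

end

section \<open>The classes\<close>

context finite_group
begin

text \<open>Cauchy's theorem, obtained from Sylow's theorem for the first power of
  \<open>p\<close>.\<close>

lemma exists_element_of_prime_order:
  assumes p: "prime p" and dvd: "p dvd Coset.order G"
  shows "\<exists>x\<in>carrier G. x \<noteq> \<one> \<and> x [^] p = \<one>"
proof -
  obtain m where "Coset.order G = p ^ 1 * m" using dvd by auto
  then obtain H where H: "subgroup H G" "card H = p"
    using sylow_thm[OF p is_group _ finite_carrier] by (metis power_one_right)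
  have "\<exists>x\<in>H. x \<noteq> \<one>"
  proof (rule ccontr)
    assume "\<not> ?thesis"
    then have "H \<subseteq> {\<one>}" by blast
    then have "card H \<le> 1" using card_mono[of "{\<one>}" H] by simp
    then show False using H(2) prime_gt_1_nat[OF p] by simp
  qed
  then obtain x where x: "x \<in> H" "x \<noteq> \<one>" by blast
  interpret H: group "G\<lparr>carrier := H\<rparr>" by (rule subgroup.subgroup_is_group[OF H(1) is_group])
  have "x [^]\<^bsub>G\<lparr>carrier := H\<rparr>\<^esub> p = \<one>"
    using H.pow_order_eq_1[of x] x(1) H(2) by (simp add: Coset.order_def)
  then have "x [^] p = \<one>" unfolding nat_pow_consistent[symmetric] .
  then show ?thesis using x subgroup.subset[OF H(1)] by blast
qed

lemma connection_set_closed: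
  assumes "connection_set G S" "s \<in> S"
  shows "s \<in> carrier G" "inv s \<in> S" "s \<noteq> \<one>"
  using assms unfolding connection_set_def by auto

lemma connection_set_inverse_pair:
  assumes "x \<in> carrier G" "x \<noteq> \<one>"
  shows "connection_set G {x, inv x}"
proof -
  have "inv x \<noteq> \<one>" using assms by simp
  then have "\<one> \<notin> {x, inv x}" using assms(2) by (metis empty_iff insert_iff)
  then show ?thesis
    using assms(1) by (simp add: connection_set_def insert_commute del: insert_iff)
qed

lemma small_connection_set_cases:
  assumes S: "connection_set G S" and card: "card S \<le> 2"
  obtains "S = {}" | t where "S = {t}" "involution t"
    | a b where "S = {a, b}" "a \<noteq> b" "involution a" "involution b"
    | x where "S = {x, inv x}" "x \<in> carrier G" "x \<noteq> inv x"
proof -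
  note cl = connection_set_closed[OF S]
  have invol: "involution s" if "s \<in> S" "inv s = s" for s
    using cl[OF that(1)] that(2) r_inv[of s] by (simp add: involution_def)
  have fin: "finite S"
    using cl(1) finite_carrier by (meson finite_subset subsetI)
  consider "card S = 0" | "card S = 1" | "card S = 2" using card by linarith
  then show ?thesis
  proof cases
    case 1
    then show ?thesis using fin that(1) by simp
  next
    case 2
    then obtain t where t: "S = {t}" by (auto simp: card_1_singleton_iff)
    then show ?thesis using that(2)[of t] invol[of t] cl(2)[of t] by simp
  next
    case 3
    then obtain a b where ab: "S = {a, b}" "a \<noteq> b" by (auto simp: card_2_iff)
    have G: "a \<in> carrier G" "b \<in> carrier G" using cl(1) ab by auto
    have inv: "inv a = a \<or> inv a = b" "inv b = a \<or> inv b = b"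
      using cl(2)[of a] cl(2)[of b] ab by auto
    show ?thesis
    proof (cases "inv a = b")
      case True
      then show ?thesis using that(4)[of a] ab G by simp
    next
      case False
      then have "inv a = a" "inv b = b" using inv ab(2) G inv_inv by metis+
      then show ?thesis using that(3)[of a b] ab invol by simp
    qed
  qed
qed

lemma group_exponent_dvd_3_iff: "group_exponent G dvd 3 \<longleftrightarrow> (\<forall>x\<in>carrier G. x [^] (3::nat) = \<one>)"
proof
  define P where "P n \<longleftrightarrow> n > 0 \<and> (\<forall>x\<in>carrier G. x [^] n = \<one>)" for n :: nat
  have e: "group_exponent G = (LEAST n. P n)" by (simp add: group_exponent_def P_def)
  \<comment> \<open>By Lagrange the group order is a candidate, so the least exponent is
    attained.\<close>
  have "P (Coset.order G)"
    using pow_order_eq_1 order_gt_0_iff_finite finite_carrier by (simp add: P_def)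
  then have PL: "P (group_exponent G)" unfolding e by (rule LeastI)
  show "\<forall>x\<in>carrier G. x [^] (3::nat) = \<one>" if "group_exponent G dvd 3"
  proof
    fix x assume x: "x \<in> carrier G"
    then have "ord x dvd group_exponent G" using PL pow_eq_id by (auto simp: P_def)
    then have "ord x dvd 3" using that by (rule dvd_trans)
    then show "x [^] (3::nat) = \<one>" using x pow_eq_id by blast
  qed
  show "group_exponent G dvd 3" if cube: "\<forall>x\<in>carrier G. x [^] (3::nat) = \<one>"
  proof (cases "carrier G = {\<one>}")
    case True
    have "group_exponent G \<le> 1" unfolding e by (rule Least_le) (simp add: P_def True)
    then show ?thesis using PL by (simp add: P_def le_Suc_eq)
  next
    case False
    then obtain x where x: "x \<in> carrier G" "x \<noteq> \<one>" by blast
    then have "ord x dvd 3" "ord x \<noteq> 1" using cube pow_eq_id ord_eq_1 by blast+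
    then have "ord x = 3" using prime_nat_iff[of 3] by (metis prime_3)
    then have "3 dvd group_exponent G" using PL x pow_eq_id by (auto simp: P_def)
    moreover have "group_exponent G \<le> 3" unfolding e by (rule Least_le) (simp add: P_def cube)
    ultimately show ?thesis using PL by (metis P_def dvd_imp_le dvd_refl le_antisym)
  qed
qed

section \<open>Inclusions between the classes\<close>

lemma class_G3_iff:
  "G \<in> class_G3 \<longleftrightarrow> (\<forall>S. connection_set G S \<and> card S \<le> 3 \<longrightarrow> integral_set S)"
  by (auto simp: class_G3_def integral_graph_Cay_iff finite_carrier is_group)

lemma class_A3_iff:
  "G \<in> class_A3 \<longleftrightarrow>
    even (Coset.order G) \<and> (\<forall>S. connection_set G S \<and> card S = 3 \<longrightarrow> integral_set S)"
  by (auto simp: class_A3_def integral_graph_Cay_iff finite_carrier is_group)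

text \<open>Oddness leaves only 1 and 3 among the orders permitted by the cosine criterion, and by
  Cauchy's theorem 3 is then the only possible prime factor of the group order.\<close>

lemma class_G3_odd_order:
  assumes G3: "G \<in> class_G3" and odd: "odd (Coset.order G)"
  shows "G \<in> three_groups_of_exponent_3"
proof -
  have cube: "x [^] (3::nat) = \<one>" if x: "x \<in> carrier G" for x
  proof (cases "x = \<one>")
    case False
    have "ord x dvd Coset.order G" using x pow_eq_id pow_order_eq_1 by blast
    then have odd_x: "odd (ord x)" using odd dvd_trans by blast
    then have ne: "x \<noteq> inv x" using odd_ord_ne_inv x False by blast
    have "card {x, inv x} \<le> 3" by (simp add: card_insert_if)
    then have "integral_set {x, inv x}"
      using G3 connection_set_inverse_pair[OF x False] unfolding class_G3_iff by blast
    then have "ord x \<in> {1, 2, 3, 4, 6}" using integral_inverse_pair_imp x ne by blast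
    then have "ord x = 1 \<or> ord x = 3" using odd_x by auto
    then have "ord x dvd 3" by auto
    then show ?thesis using x pow_eq_id by blast
  qed simp
  have "\<exists>k. Coset.order G = 3 ^ k"
  proof (rule power_if_only_prime_factor)
    show "0 < Coset.order G" using odd by (cases "Coset.order G") auto
    fix q :: nat assume q: "prime q" "q dvd Coset.order G"
    then obtain x where x: "x \<in> carrier G" "x \<noteq> \<one>" "x [^] q = \<one>"
      using exists_element_of_prime_order by blast
    then have "ord x dvd q" "ord x dvd 3" "ord x \<noteq> 1" using cube pow_eq_id ord_eq_1 by blast+
    then show "q = 3" using q(1) by (metis prime_3 prime_nat_iff)
  qed simp
  then show ?thesis
    using cube group_exponent_dvd_3_iff finite_carrier is_group
    by (simp add: three_groups_of_exponent_3_def finite_p_group_def)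
qed

text \<open>There are no involutions, so \<open>S\<close> is a disjoint union of pairs
  \<open>{x, inv x}\<close>, and three elements leave room for at most one pair.\<close>

lemma exponent_3_class_G3:
  assumes G: "G \<in> three_groups_of_exponent_3"
  shows "G \<in> class_G3"
  unfolding class_G3_iff
proof (intro allI impI, elim conjE)
  fix S assume S: "connection_set G S" and card: "card S \<le> 3"
  note cl = connection_set_closed[OF S]
  have cube: "x [^] (3::nat) = \<one>" if "x \<in> carrier G" for x
    using G that group_exponent_dvd_3_iff by (simp add: three_groups_of_exponent_3_def)
  have noinv: "inv x \<noteq> x" if x: "x \<in> carrier G" "x \<noteq> \<one>" for x
  proof
    assume "inv x = x"
    then have "x \<otimes> x = \<one>" using x r_inv by metis
    then have "x [^] (3::nat) = x" using x(1) by (simp add: numeral_3_eq_3)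
    then show False using cube x by simp
  qed
  have fin: "finite S"
    using cl(1) finite_carrier by (meson finite_subset subsetI)
  show "integral_set S"
  proof (cases "S = {}")
    case False
    then obtain x where x: "x \<in> S" by blast
    have "S = {x, inv x}"
    proof (rule ccontr)
      assume "S \<noteq> {x, inv x}"
      then obtain y where y: "y \<in> S" "y \<noteq> x" "y \<noteq> inv x" using x cl by blast
      have "inv y \<noteq> x" "inv y \<noteq> inv x" "inv y \<noteq> y"
        using noinv[of y] inv_inv[of y] inv_inv[of x] cl[OF x] cl[OF y(1)] y by auto
      moreover have "inv x \<noteq> x" using noinv cl[OF x] by blast
      ultimately have "card {x, inv x, y, inv y} = 4" using y by simp
      moreover have "{x, inv x, y, inv y} \<subseteq> S" using x y cl by blast
      ultimately show False using card card_mono[OF fin, of "{x, inv x, y, inv y}"] by simp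
    qed
    then show ?thesis
      using integral_set_cube_eq_one[of x] cube noinv cl[OF x] by metis
  qed (simp add: integral_set_empty)
qed

lemma class_A3_class_G3:
  assumes G: "G \<in> class_A3"
  shows "G \<in> class_G3"
proof -
  interpret cubic_integral_group G
    using G class_A3_iff by unfold_locales blast
  \<comment> \<open>Even order supplies the involution required by
    \<open>integral_set_inverse_pair\<close>.\<close>
  have "2 dvd Coset.order G" using G class_A3_iff by blast
  then obtain t where "t \<in> carrier G" "t \<noteq> \<one>" "t [^] (2::nat) = \<one>"
    using exists_element_of_prime_order[OF two_is_prime_nat] by blast
  then have t: "involution t" by (simp add: involution_def numeral_2_eq_2)
  show ?thesis
    unfolding class_G3_iff
  proof (intro allI impI, elim conjE)
    fix S assume S: "connection_set G S" and "card S \<le> 3"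
    then consider "card S = 3" | "card S \<le> 2" by linarith
    then show "integral_set S"
    proof cases
      case 1
      then show ?thesis by (rule cubic_integral[OF S])
    next
      case 2
      show ?thesis
        using S 2
      proof (cases rule: small_connection_set_cases)
        case 1
        then show ?thesis by (simp add: integral_set_empty)
      next
        case (2 t)
        then show ?thesis by (simp add: integral_set_involution)
      next
        case (3 a b)
        then show ?thesis by (simp add: integral_set_two_involutions involutions_cases)
      next
        case (4 x)
        then show ?thesis using integral_set_inverse_pair[OF t] by simp
      qed
    qed
  qed
qed

end

theorem corollary2p7:
  shows "(class_G3 :: ('a, 'b) monoid_scheme set) = three_groups_of_exponent_3 \<union> class_A3"
proof (intro equalityI subsetI)
  fix G :: "('a, 'b) monoid_scheme"
  assume G: "G \<in> class_G3"
  then interpret finite_group G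
    by (auto simp: class_G3_def finite_group_def finite_group_axioms_def)
  show "G \<in> three_groups_of_exponent_3 \<union> class_A3"
    \<comment> \<open>Odd order leads to exponent 3; for even order, sets of size exactly 3 are
      covered by the bound.\<close>
    using G class_G3_odd_order class_G3_iff class_A3_iff by auto
next
  fix G :: "('a, 'b) monoid_scheme"
  assume G: "G \<in> three_groups_of_exponent_3 \<union> class_A3"
  then interpret finite_group G
    by (auto simp: three_groups_of_exponent_3_def finite_p_group_def class_A3_def
        finite_group_def finite_group_axioms_def)
  show "G \<in> class_G3"
    using G exponent_3_class_G3 class_A3_class_G3 by blast
qed

end
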